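(* Let $\Bbbk$ be an algebraically closed field of characteristic $p>2$ and let $\mathcal{J}$ be the super Jordan plane over $\Bbbk$, with $s=xy+yx$. Then: (1) For any $\alpha\in\Bbbk$, the $\mathcal{J}$-module $S_\alpha:=\mathcal{J}/\langle s,x,y-\alpha\rangle$ is simple. (2) For $\alpha\in\Bbbk^*$ and $\beta\in\Bbbk$, the $\mathcal{J}$-module $V_{\alpha,\beta}:=\mathcal{J}/\mathcal{J}(x,\,s-\alpha,\,y^{2p}-\beta)$ is simple of dimension $2p$. (3) The set of isomorphism classes of simple $\mathcal{J}$-modules is $$\widehat{\mathcal{J}}=\{[S_\alpha]\mid\alpha\in\Bbbk\}\cup\{[V_{\alpha,\beta}]\mid\alpha\in\Bbbk^*,\ \beta\in\Bbbk\}.$$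
   Context: The super Jordan plane $\mathcal{J}$ over a field $\Bbbk$ is the unital associative $\Bbbk$-algebra generated by $x,y$ with defining relations $x^2=0$ and $y^2x-xy^2-xyx=0$. Put $s:=xy+yx$. The elements $x^is^jy^k$ ($i\in\{0,1\}$, $j,k\geq 0$) form a $\Bbbk$-basis of $\mathcal{J}$. All modules are left modules; dimension is over $\Bbbk$. $\langle\cdots\rangle$ denotes the two-sided ideal, and $\mathcal{J}(a,b,c)=\mathcal{J}a+\mathcal{J}b+\mathcal{J}c$ the left ideal, generated by the listed elements. $[M]$ is the isomorphism class of a module $M$, and $\Bbbk^*=\Bbbk\setminus\{0\}$. *)

theory Defs
  imports
    "Jordan_Normal_Form.VS_Connect"
    "HOL-Algebra.QuotRing"
    "HOL-Library.Poly_Mapping"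
begin

datatype gen = GX | GY

datatype word = Word (letters: "gen list")

text \<open>The free monoid is written additively because the convolution product on
  finitely supported functions requires an index type of class \<open>monoid_add\<close>;
  \<open>+\<close> on words is concatenation and is not commutative.\<close>

instantiation word :: monoid_add
begin

definition zero_word :: word where "0 = Word []"

definition plus_word :: "word \<Rightarrow> word \<Rightarrow> word" where
  "u + v = Word (letters u @ letters v)"

instance
  by standard (simp_all add: zero_word_def plus_word_def)

end

type_synonym 'k free_alg = "word \<Rightarrow>\<^sub>0 'k"

definition free_x :: "'k::field free_alg" where
  "free_x = Poly_Mapping.single (Word [GX]) 1"

definition free_y :: "'k::field free_alg" where
  "free_y = Poly_Mapping.single (Word [GY]) 1"

definition free_const :: "'k::field \<Rightarrow> 'k free_alg" where
  "free_const c = Poly_Mapping.single 0 c"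

definition sj_ideal :: "'k::field free_alg set" where
  "sj_ideal = Idl\<^bsub>class_ring\<^esub>
     {free_x ^ 2,
      free_y ^ 2 * free_x - free_x * free_y ^ 2 - free_x * free_y * free_x}"

lemma ring_class_ring: "ring (class_ring :: 'r::ring_1 ring)"
  ..

lemma ideal_sj_ideal: "ideal sj_ideal (class_ring :: 'k::field free_alg ring)"
  unfolding sj_ideal_def by (rule ring.genideal_ideal[OF ring_class_ring]) simp

lemma sj_ideal_0: "0 \<in> sj_ideal"
  and sj_ideal_add: "a \<in> sj_ideal \<Longrightarrow> b \<in> sj_ideal \<Longrightarrow> a + b \<in> sj_ideal"
  and sj_ideal_l: "a \<in> sj_ideal \<Longrightarrow> c * a \<in> sj_ideal"
  and sj_ideal_r: "a \<in> sj_ideal \<Longrightarrow> a * c \<in> sj_ideal"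
  using additive_subgroup.zero_closed[OF ideal.axioms(1)[OF ideal_sj_ideal]]
    additive_subgroup.a_closed[OF ideal.axioms(1)[OF ideal_sj_ideal], of a b]
    ideal.I_l_closed[OF ideal_sj_ideal, of a c]
    ideal.I_r_closed[OF ideal_sj_ideal, of a c]
  by simp_all

lemma sj_ideal_uminus: "a \<in> sj_ideal \<Longrightarrow> - a \<in> sj_ideal"
  using sj_ideal_l[of a "- 1"] by simp

lemma sj_ideal_diff: "a \<in> sj_ideal \<Longrightarrow> b \<in> sj_ideal \<Longrightarrow> a - b \<in> sj_ideal"
  using sj_ideal_add[of a "- b"] sj_ideal_uminus[of b] by simp

lemma sj_ideal_gens:
  "free_x ^ 2 \<in> sj_ideal"
  "free_y ^ 2 * free_x - free_x * free_y ^ 2 - free_x * free_y * free_x \<in> sj_ideal"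
  using ring.genideal_self[OF ring_class_ring, of
      "{free_x ^ 2, free_y ^ 2 * free_x - free_x * free_y ^ 2 - free_x * free_y * free_x}"]
  unfolding sj_ideal_def by auto

text \<open>The constant coefficient is an algebra homomorphism killing the relations,
  so the quotient is not the zero ring.\<close>

lemma word_add_eq_0_iff: "0 = u + (v :: word) \<longleftrightarrow> u = 0 \<and> v = 0"
  by (cases u; cases v) (auto simp: zero_word_def plus_word_def)

lemma lookup_times_0:
  "Poly_Mapping.lookup (f * g :: 'k::field free_alg) 0 =
     Poly_Mapping.lookup f 0 * Poly_Mapping.lookup g 0"
proof -
  have "(\<Sum>q. Poly_Mapping.lookup g q when (0::word) = l + q) =
      (Poly_Mapping.lookup g 0 when l = 0)" for l
    by (cases "l = 0") (simp_all add: word_add_eq_0_iff)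
  then show ?thesis
    by (simp add: times_poly_mapping.rep_eq prod_fun_def mult_when)
qed

lemma lookup_free_x_0: "Poly_Mapping.lookup free_x 0 = 0"
  by (simp add: free_x_def lookup_single zero_word_def)

lemma lookup_sj_ideal_0:
  assumes "f \<in> sj_ideal"
  shows "Poly_Mapping.lookup (f :: 'k::field free_alg) 0 = 0"
proof -
  let ?K = "{f :: 'k free_alg. Poly_Mapping.lookup f 0 = 0}"
  have inv: "inv\<^bsub>add_monoid class_ring\<^esub> a = - a" for a :: "'k free_alg"
    unfolding a_inv_def[symmetric] by (simp add: class_ring_simps)
  have "ideal ?K class_ring"
  proof (rule idealI[OF ring_class_ring])
    show "subgroup ?K (add_monoid class_ring)"
      by (rule group.subgroupI[OF abelian_group.a_group[OF ring.is_abelian_group[OF ring_class_ring]]])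
        (auto simp: lookup_add inv[simplified] intro: exI[of _ 0])
  qed (auto simp: lookup_times_0)
  moreover have "free_x ^ 2 \<in> ?K"
    "free_y ^ 2 * free_x - free_x * free_y ^ 2 - free_x * free_y * free_x \<in> ?K"
    by (simp_all add: lookup_times_0 lookup_minus power2_eq_square lookup_free_x_0)
  ultimately show ?thesis
    using assms unfolding sj_ideal_def genideal_def by blast
qed

lemma one_notin_sj_ideal: "1 \<notin> sj_ideal"
  using lookup_sj_ideal_0[of 1] by auto

quotient_type (overloaded) 'k super_jordan = "'k::field free_alg" / "\<lambda>a b. a - b \<in> sj_ideal"
proof (rule equivpI)
  show "reflp (\<lambda>a b :: 'k free_alg. a - b \<in> sj_ideal)"
    by (rule reflpI) (simp add: sj_ideal_0)
  show "symp (\<lambda>a b :: 'k free_alg. a - b \<in> sj_ideal)"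
    by (rule sympI) (metis minus_diff_eq sj_ideal_uminus)
  show "transp (\<lambda>a b :: 'k free_alg. a - b \<in> sj_ideal)"
    by (rule transpI) (metis diff_add_cancel add_diff_eq sj_ideal_add)
qed

instantiation super_jordan :: (field) ring_1
begin

lift_definition zero_super_jordan :: "'a super_jordan" is 0 .

lift_definition one_super_jordan :: "'a super_jordan" is 1 .

lift_definition plus_super_jordan :: "'a super_jordan \<Rightarrow> 'a super_jordan \<Rightarrow> 'a super_jordan"
  is "(+)"
  by (metis add_diff_add sj_ideal_add)

lift_definition uminus_super_jordan :: "'a super_jordan \<Rightarrow> 'a super_jordan" is uminus
  by (metis minus_diff_minus sj_ideal_uminus)

lift_definition minus_super_jordan :: "'a super_jordan \<Rightarrow> 'a super_jordan \<Rightarrow> 'a super_jordan"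
  is "(-)"
proof -
  fix a b c d :: "'a free_alg"
  assume "a - b \<in> sj_ideal" "c - d \<in> sj_ideal"
  then have "(a - b) - (c - d) \<in> sj_ideal" by (rule sj_ideal_diff)
  then show "(a - c) - (b - d) \<in> sj_ideal" by (simp add: algebra_simps)
qed

lift_definition times_super_jordan :: "'a super_jordan \<Rightarrow> 'a super_jordan \<Rightarrow> 'a super_jordan"
  is "(*)"
proof -
  fix a b c d :: "'a free_alg"
  assume "a - b \<in> sj_ideal" "c - d \<in> sj_ideal"
  then have "(a - b) * c + b * (c - d) \<in> sj_ideal"
    by (intro sj_ideal_add sj_ideal_l sj_ideal_r)
  then show "a * c - b * d \<in> sj_ideal" by (simp add: algebra_simps)
qed

instance
proof
  show "(0 :: 'a super_jordan) \<noteq> 1"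
    by transfer (metis diff_0 minus_minus one_notin_sj_ideal sj_ideal_uminus)
qed (transfer; simp add: algebra_simps sj_ideal_0)+

end

lift_definition sj_x :: "'k::field super_jordan" is free_x .

lift_definition sj_y :: "'k::field super_jordan" is free_y .

lift_definition sj_const :: "'k::field \<Rightarrow> 'k super_jordan" is free_const .

definition sj_s :: "'k::field super_jordan" where
  "sj_s = sj_x * sj_y + sj_y * sj_x"

lemma sj_relations:
  "sj_x ^ 2 = (0 :: 'k::field super_jordan)"
  "sj_y ^ 2 * sj_x - sj_x * sj_y ^ 2 - sj_x * sj_y * sj_x = (0 :: 'k super_jordan)"
  unfolding power2_eq_square
  by (transfer, use sj_ideal_gens in \<open>simp add: power2_eq_square\<close>)+

text \<open>The library locale \<open>module\<close> with the commutativity of the ring dropped.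
  As there, the \<open>mult\<close> and \<open>one\<close> fields of the record \<open>M\<close> play no role.\<close>

locale left_module = R?: ring R + M?: abelian_group M
  for R :: "('r, 'b) ring_scheme" (structure) and M :: "('r, 'm, 'c) module_scheme" (structure) +
  assumes smult_closed:
      "\<lbrakk>a \<in> carrier R; u \<in> carrier M\<rbrakk> \<Longrightarrow> a \<odot>\<^bsub>M\<^esub> u \<in> carrier M"
    and smult_l_distr:
      "\<lbrakk>a \<in> carrier R; b \<in> carrier R; u \<in> carrier M\<rbrakk> \<Longrightarrow>
        (a \<oplus> b) \<odot>\<^bsub>M\<^esub> u = a \<odot>\<^bsub>M\<^esub> u \<oplus>\<^bsub>M\<^esub> b \<odot>\<^bsub>M\<^esub> u"
    and smult_r_distr:
      "\<lbrakk>a \<in> carrier R; u \<in> carrier M; v \<in> carrier M\<rbrakk> \<Longrightarrow>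
        a \<odot>\<^bsub>M\<^esub> (u \<oplus>\<^bsub>M\<^esub> v) = a \<odot>\<^bsub>M\<^esub> u \<oplus>\<^bsub>M\<^esub> a \<odot>\<^bsub>M\<^esub> v"
    and smult_assoc:
      "\<lbrakk>a \<in> carrier R; b \<in> carrier R; u \<in> carrier M\<rbrakk> \<Longrightarrow>
        (a \<otimes> b) \<odot>\<^bsub>M\<^esub> u = a \<odot>\<^bsub>M\<^esub> (b \<odot>\<^bsub>M\<^esub> u)"
    and smult_one:
      "u \<in> carrier M \<Longrightarrow> \<one> \<odot>\<^bsub>M\<^esub> u = u"

definition simple_module :: "('r, 'b) ring_scheme \<Rightarrow> ('r, 'm, 'c) module_scheme \<Rightarrow> bool" where
  "simple_module R M \<longleftrightarrow>
     left_module R M \<and> carrier M \<noteq> {\<zero>\<^bsub>M\<^esub>} \<and>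
     (\<forall>N. Module.submodule N R M \<longrightarrow> N = {\<zero>\<^bsub>M\<^esub>} \<or> N = carrier M)"

definition module_iso ::
  "('r, 'b) ring_scheme \<Rightarrow> ('r, 'm, 'c) module_scheme \<Rightarrow> ('r, 'n, 'd) module_scheme \<Rightarrow> bool" where
  "module_iso R M N \<longleftrightarrow> (\<exists>f \<in> LinearCombinations.module_hom R M N. bij_betw f (carrier M) (carrier N))"

text \<open>The isomorphism class of \<open>M\<close> inside the universe of modules whose elements
  are of type \<open>'n\<close>. A simple left module over \<open>R\<close> is cyclic, hence isomorphic to a
  quotient of \<open>R\<close>, so the universe \<open>'n = 'r set\<close> contains a representative of every
  class of simple modules.\<close>

definition iso_class ::
  "('r, 'b) ring_scheme \<Rightarrow> ('r, 'm, 'c) module_scheme \<Rightarrow> ('r, 'n) module set" where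
  "iso_class R M = {N. left_module R N \<and> module_iso R M N}"

text \<open>The left module \<open>R/L\<close> for a left ideal \<open>L\<close>; scalar multiplication is
  \<open>a \<cdot> (L + r) = L + a r\<close>, written like \<open>rcoset_mult\<close>.\<close>

definition quot_module :: "('r, 'b) ring_scheme \<Rightarrow> 'r set \<Rightarrow> ('r, 'r set) module" where
  "quot_module R L =
    \<lparr>carrier = a_rcosets\<^bsub>R\<^esub> L, mult = undefined, one = undefined,
     zero = L, add = set_add R,
     smult = (\<lambda>a U. \<Union>r\<in>U. L +>\<^bsub>R\<^esub> (a \<otimes>\<^bsub>R\<^esub> r))\<rparr>"

abbreviation SJ :: "'k::field super_jordan ring" where
  "SJ \<equiv> class_ring"

definition left_ideal3 ::
  "'k::field super_jordan \<Rightarrow> 'k super_jordan \<Rightarrow> 'k super_jordan \<Rightarrow> 'k super_jordan set" where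
  "left_ideal3 a b c = {f * a + g * b + h * c | f g h. True}"

definition S_mod :: "'k::field \<Rightarrow> ('k super_jordan, 'k super_jordan set) module" where
  "S_mod \<alpha> = quot_module SJ (Idl\<^bsub>SJ\<^esub> {sj_s, sj_x, sj_y - sj_const \<alpha>})"

definition V_mod :: "nat \<Rightarrow> 'k::field \<Rightarrow> 'k \<Rightarrow> ('k super_jordan, 'k super_jordan set) module" where
  "V_mod p \<alpha> \<beta> = quot_module SJ
     (left_ideal3 sj_x (sj_s - sj_const \<alpha>) (sj_y ^ (2 * p) - sj_const \<beta>))"

definition base_space :: "('k::field super_jordan, 'm) module \<Rightarrow> ('k, 'm) module" where
  "base_space M =
    \<lparr>carrier = carrier M, mult = mult M, one = one M, zero = zero M, add = add M,
     smult = (\<lambda>c u. sj_const c \<odot>\<^bsub>M\<^esub> u)\<rparr>"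

text \<open>\<open>vectorspace.dim\<close> is only meaningful together with \<open>fin_dim\<close>.\<close>

definition has_dimension :: "('k::field super_jordan, 'm) module \<Rightarrow> nat \<Rightarrow> bool" where
  "has_dimension M n \<longleftrightarrow>
     vectorspace class_ring (base_space M) \<and>
     vectorspace.fin_dim class_ring (base_space M) \<and>
     vectorspace.dim class_ring (base_space M) = n"

end

(* Put t = y^2. Then t x = x (t + s), t s = s (t + s) and x s = s x, so in characteristic p the
   elements s^p and t^p are central.

   A simple module is J/L for a maximal left ideal L, and s acts on it either as zero or
   injectively. If s acts as zero then so does x, and an eigenvector of y generates a copy of some
   S_alpha. If s acts injectively, pick a vector m with x m = 0, so that J m = N + y N with
   N = k<s,t> m. If no nonzero polynomial in s killed m, then s^p - g^p would be invertible for
   every g; solving m = (s^p - g^p) u in N, where up to powers of one polynomial h(s) everything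
   has unique coordinates over k[s], forces h(g) = 0 for all g. Hence s has an eigenvector w with
   x w = 0, then t has an eigenvector in k[t] w, the central element t^p acts as a scalar, and the
   module is a quotient of some V_{alpha,beta}.

   Every element of V_{alpha,beta} is f(t) + y g(t) with f and g of degree less than p. Multiplying
   by s^(p-1) x isolates g, and s^(p-1) then acts as differentiation, so every nonzero element
   generates 1. That V_{alpha,beta} is nonzero is seen on the representation on pairs of
   polynomials (f, g), read as f(t) + y g(t), in which s is the inverse of 1/alpha + d/dt. *)

theory Submission
  imports Defs "HOL-Library.Product_Plus"
begin

text \<open>Nothing bounds the size of a simple module in advance, and k may be countable, so
  eigenvectors of s and t come neither from finite dimension nor from counting independent
  resolvents. Centrality of p-th powers replaces this: s^p - g^p = (s - g)^p is a central polynomial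
  in s with root g, and a central element acts on a simple module as zero or bijectively. The
  polynomial h is the leading coefficient of a relation sum f_i(s) t^i m = 0 of least degree in t,
  or 1 if there is no relation. Inverting h makes powers of t a basis of N over k[s], and solving m
  = (s - g)^p u then forces (s - g)^p to divide a power of h.

  Vectors are handled through left ideals: a maximal L is the annihilator of the class of 1 in J/L,
  and c kills the class of b exactly when c * b lies in L. Passing to another vector u replaces L by
  {a. a * u in L}, again maximal if u is not in L. The identification with a model is an equality of
  left ideals, since nested maximal left ideals coincide.\<close>

section \<open>Scalars and induction over the algebra\<close>

lemma sj_const_0 [simp]: "sj_const (0 :: 'k::field) = 0"
  by transfer (simp add: free_const_def sj_ideal_0)

lemma sj_const_1 [simp]: "sj_const (1 :: 'k::field) = 1"
  by transfer (simp add: free_const_def sj_ideal_0)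

lemma sj_const_add: "sj_const (a + b :: 'k::field) = sj_const a + sj_const b"
  by transfer (simp add: free_const_def single_add sj_ideal_0)

lemma sj_const_mult: "sj_const (a * b :: 'k::field) = sj_const a * sj_const b"
  by transfer (simp add: free_const_def mult_single sj_ideal_0)

lemma sj_const_uminus: "sj_const (- a :: 'k::field) = - sj_const a"
  using sj_const_add[of a "- a"] by (simp add: minus_unique)

lemma sj_const_of_nat: "sj_const (of_nat n :: 'k::field) = of_nat n"
  by (induction n) (simp_all add: sj_const_add)

lemma free_alg_induct [case_names single add]:
  assumes "\<And>w c. P (Poly_Mapping.single w c)"
    and "\<And>f g. P f \<Longrightarrow> P g \<Longrightarrow> P (f + g)"
  shows "P (f :: 'k::field free_alg)"
proof -
  have "P (\<Sum>w\<in>A. Poly_Mapping.single w (Poly_Mapping.lookup f w))" if "finite A" for A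
    using that
  proof (induction A rule: finite_induct)
    case empty
    then show ?case using assms(1)[of 0 0] by simp
  qed (simp add: assms)
  moreover have "f = (\<Sum>w\<in>Poly_Mapping.keys f. Poly_Mapping.single w (Poly_Mapping.lookup f w))"
    by (rule poly_mapping_eqI)
      (auto simp: lookup_sum lookup_single when_def sum.delta' in_keys_iff)
  ultimately show ?thesis by (metis finite_keys)
qed

lemma sj_const_commute: "a * sj_const c = sj_const c * (a :: 'k::field super_jordan)"
proof transfer
  fix a :: "'k free_alg" and c :: 'k
  have "a * free_const c = free_const c * a"
    by (induction a rule: free_alg_induct)
      (simp_all add: free_const_def mult_single distrib_left distrib_right mult.commute)
  then show "a * free_const c - free_const c * a \<in> sj_ideal"
    by (simp add: sj_ideal_0)
qed

text \<open>Words are built up from the left, so each step multiplies by a generator on the left.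
  This is the shape needed to show that a condition on vectors of a left module is preserved by the
  whole algebra.\<close>

lemma super_jordan_induct [case_names one const x y add]:
  fixes a :: "'k::field super_jordan"
  assumes "P 1" "\<And>c a. P a \<Longrightarrow> P (sj_const c * a)"
    and "\<And>a. P a \<Longrightarrow> P (sj_x * a)" "\<And>a. P a \<Longrightarrow> P (sj_y * a)"
    and "\<And>a b. P a \<Longrightarrow> P b \<Longrightarrow> P (a + b)"
  shows "P a"
proof -
  have "P (abs_super_jordan f)" for f :: "'k free_alg"
  proof (induction f rule: free_alg_induct)
    case (single w c)
    have "P (abs_super_jordan (Poly_Mapping.single (Word l) 1))" for l
    proof (induction l)
      case Nil
      have "abs_super_jordan (Poly_Mapping.single (Word []) 1) = (1 :: 'k super_jordan)"
        unfolding zero_word_def[symmetric] by (simp add: one_super_jordan.abs_eq)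
      then show ?case using assms(1) by simp
    next
      case (Cons g l)
      have "Poly_Mapping.single (Word (g # l)) (1::'k) =
          Poly_Mapping.single (Word [g]) 1 * Poly_Mapping.single (Word l) 1"
        by (simp add: mult_single plus_word_def)
      then have "abs_super_jordan (Poly_Mapping.single (Word (g # l)) (1::'k)) =
          abs_super_jordan (Poly_Mapping.single (Word [g]) 1) *
          abs_super_jordan (Poly_Mapping.single (Word l) 1)"
        by (simp only: times_super_jordan.abs_eq)
      moreover have "abs_super_jordan (Poly_Mapping.single (Word [GX]) 1) = (sj_x :: 'k super_jordan)"
        "abs_super_jordan (Poly_Mapping.single (Word [GY]) 1) = (sj_y :: 'k super_jordan)"
        by (simp_all add: sj_x.abs_eq sj_y.abs_eq free_x_def free_y_def)
      ultimately show ?case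
        by (cases g) (use Cons assms(3,4) in simp_all)
    qed
    then have "P (sj_const c * abs_super_jordan (Poly_Mapping.single w 1))"
      by (cases w) (simp add: assms(2))
    then show ?case
      by (simp add: sj_const.abs_eq times_super_jordan.abs_eq free_const_def mult_single)
  next
    case (add f g)
    then show ?case using assms(5) by (simp add: plus_super_jordan.abs_eq[symmetric])
  qed
  then show ?thesis by (rule super_jordan.abs_induct)
qed

section \<open>Commutation rules for x, y, s and t\<close>

definition sj_t :: "'k::field super_jordan" where
  "sj_t = sj_y * sj_y"

lemma sj_x_x [simp]: "sj_x * sj_x = (0 :: 'k::field super_jordan)"
  using sj_relations(1) by (simp add: power2_eq_square)

lemma sj_x_x_left [simp]: "sj_x * (sj_x * a) = (0 :: 'k::field super_jordan)"
  by (simp add: mult.assoc[symmetric])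

lemma sj_x_s: "sj_x * sj_s = sj_s * (sj_x :: 'k::field super_jordan)"
  by (simp add: sj_s_def distrib_left distrib_right mult.assoc)

lemma sj_x_y: "sj_x * sj_y = sj_s - sj_y * (sj_x :: 'k::field super_jordan)"
  by (simp add: sj_s_def)

text \<open>This is the second defining relation: x s = x y x because x^2 = 0.\<close>

lemma sj_t_x: "sj_t * sj_x = sj_x * (sj_t + sj_s :: 'k::field super_jordan)"
  using sj_relations(2)[where 'k='k]
  by (simp add: sj_s_def sj_t_def distrib_left mult.assoc power2_eq_square diff_eq_eq add.commute)

lemma sj_y_s: "sj_y * sj_s = sj_s * (sj_y + sj_x :: 'k::field super_jordan)"
proof -
  have "sj_y * sj_s = sj_y * sj_x * sj_y + sj_t * (sj_x :: 'k super_jordan)"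
    by (simp add: sj_s_def sj_t_def distrib_left mult.assoc)
  then show ?thesis
    by (simp add: sj_t_x) (simp add: sj_s_def sj_t_def distrib_left distrib_right mult.assoc)
qed

lemma sj_t_y: "sj_t * sj_y = sj_y * (sj_t :: 'k::field super_jordan)"
  by (simp add: sj_t_def mult.assoc)

text \<open>Moving s to the left past y turns y into y + x, and (y + x)^2 = t + s because x^2 =
  0.\<close>

lemma sj_t_s: "sj_t * sj_s = sj_s * sj_t + sj_s * (sj_s :: 'k::field super_jordan)"
proof -
  have "sj_t * sj_s = sj_s * ((sj_y + sj_x) * (sj_y + sj_x :: 'k super_jordan))"
    by (simp only: sj_t_def mult.assoc sj_y_s) (simp only: mult.assoc[symmetric] sj_y_s)
  also have "(sj_y + sj_x) * (sj_y + sj_x) = (sj_t + sj_s :: 'k super_jordan)"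
    by (simp add: sj_t_def sj_s_def distrib_left distrib_right)
  finally show ?thesis by (simp add: distrib_left)
qed

subsection \<open>Evaluation of polynomials\<close>

definition sj_eval :: "'k::field poly \<Rightarrow> 'k super_jordan \<Rightarrow> 'k super_jordan" where
  "sj_eval f a = fold_coeffs (\<lambda>c r. sj_const c + a * r) f 0"

lemma sj_eval_0 [simp]: "sj_eval 0 a = 0"
  by (simp add: sj_eval_def)

lemma sj_eval_pCons [simp]: "sj_eval (pCons c f) a = sj_const c + a * sj_eval f a"
  by (cases "c = 0 \<and> f = 0") (auto simp: sj_eval_def)

lemma sj_eval_1 [simp]: "sj_eval 1 a = 1"
  by (simp add: one_pCons)

lemma sj_eval_add: "sj_eval (f + g) a = sj_eval f a + sj_eval g a"
proof (induction f arbitrary: g)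
  case (pCons c f)
  show ?case
  proof (cases g)
    fix d h
    assume "g = pCons d h"
    then show ?thesis by (simp add: pCons.IH sj_const_add distrib_left)
  qed
qed simp

lemma sj_eval_smult: "sj_eval (Polynomial.smult c f) a = sj_const c * sj_eval f a"
proof (induction f)
  case (pCons d f)
  have "a * (sj_const c * sj_eval f a) = sj_const c * (a * sj_eval f a)"
    by (metis mult.assoc sj_const_commute)
  with pCons show ?case by (simp add: sj_const_mult distrib_left)
qed simp

lemma sj_eval_mult: "sj_eval (f * g) a = sj_eval f a * sj_eval g a"
  by (induction f) (simp_all add: sj_eval_add sj_eval_smult distrib_right mult.assoc)

lemma sj_eval_mult': "sj_eval (f * g) a = sj_eval g a * sj_eval f a"
  by (subst mult.commute) (rule sj_eval_mult)

lemma sj_eval_uminus: "sj_eval (- f) a = - sj_eval f a"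
  using sj_eval_add[of f "- f" a] by (simp add: minus_unique)

lemma sj_eval_diff: "sj_eval (f - g) a = sj_eval f a - sj_eval g a"
  using sj_eval_add[of f "- g" a] by (simp add: sj_eval_uminus)

lemma sj_eval_power: "sj_eval (f ^ n) a = sj_eval f a ^ n"
  by (induction n) (simp_all add: sj_eval_mult)

lemma sj_eval_monom [simp]: "sj_eval (monom c n) a = sj_const c * a ^ n"
proof (induction n)
  case (Suc n)
  then show ?case
    by (simp add: monom_Suc) (metis mult.assoc sj_const_commute)
qed (simp add: monom_0)

lemma sj_eval_commute:
  assumes "b * a = a * b"
  shows "b * sj_eval f a = sj_eval f a * b"
proof (induction f)
  case (pCons c f)
  have "b * (a * sj_eval f a) = a * sj_eval f a * b"
    by (metis assms mult.assoc pCons.IH)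
  then show ?case
    by (simp add: distrib_left distrib_right sj_const_commute)
qed simp

text \<open>As [t, s] = s^2, the commutator with t acts on k[s] as the derivation s^2 d/ds;
  \<open>monom 1 2\<close> is the factor s^2.\<close>

lemma sj_t_eval_s:
  "sj_t * sj_eval f sj_s = sj_eval f sj_s * sj_t + sj_eval (monom 1 2 * pderiv f) (sj_s :: 'k::field super_jordan)"
proof (induction f)
  case (pCons c f)
  have "sj_t * (sj_s * sj_eval f sj_s) = sj_s * (sj_t * sj_eval f sj_s) + sj_s * sj_s * sj_eval f (sj_s :: 'k super_jordan)"
    by (simp add: mult.assoc[symmetric] sj_t_s distrib_right)
  also have "\<dots> = sj_s * sj_eval f sj_s * sj_t + sj_eval (monom 1 2 * pderiv (pCons c f)) sj_s"
    by (simp add: pCons.IH pderiv_pCons sj_eval_add sj_eval_mult distrib_left mult.assoc power2_eq_square)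
  finally show ?case
    by (simp add: distrib_left distrib_right sj_const_commute)
qed simp

section \<open>Centrality of the p-th powers of s and t\<close>

text \<open>The k-fold commutator of t with \<open>a 0\<close> is k! times \<open>a k\<close>, so
  this is the Leibniz formula for moving t^n past \<open>a 0\<close>. Keeping k! outside the
  elements \<open>a k\<close> makes the coefficients integers that can vanish in characteristic
  p.\<close>

lemma power_mult_iterated_commutator:
  fixes t :: "'r::ring_1" and a :: "nat \<Rightarrow> 'r"
  assumes "\<And>k. t * a k = a k * t + of_nat (Suc k) * a (Suc k)"
  shows "t ^ n * a 0 = (\<Sum>k\<le>n. of_nat ((n choose k) * fact k) * (a k * t ^ (n - k)))"
proof (induction n)
  case (Suc n)
  define c :: "nat \<Rightarrow> nat \<Rightarrow> 'r" where "c m k = of_nat ((m choose k) * fact k)" for m k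
  have comm: "t * (c m k * b) = c m k * (t * b)" for m k b
    unfolding c_def by (metis mult.assoc mult_of_nat_commute)
  have c_Suc: "c (Suc n) (Suc k) = c n (Suc k) + c n k * of_nat (Suc k)" for k
    unfolding c_def of_nat_mult[symmetric] of_nat_add[symmetric]
    by (simp add: algebra_simps del: of_nat_mult of_nat_add)
  have "t ^ Suc n * a 0 = (\<Sum>k\<le>n. t * (c n k * (a k * t ^ (n - k))))"
    by (simp add: mult.assoc Suc.IH c_def sum_distrib_left del: of_nat_mult)
  also have "\<dots> = (\<Sum>k\<le>n. c n k * (a k * t ^ (Suc n - k))) +
      (\<Sum>k\<le>n. c n k * of_nat (Suc k) * (a (Suc k) * t ^ (n - k)))"
    unfolding sum.distrib[symmetric]
  proof (rule sum.cong[OF refl])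
    fix k assume "k \<in> {..n}"
    then have "a k * t ^ (Suc n - k) = a k * t * t ^ (n - k)"
      by (simp add: Suc_diff_le mult.assoc)
    moreover have "t * (a k * t ^ (n - k)) =
        a k * t * t ^ (n - k) + of_nat (Suc k) * (a (Suc k) * t ^ (n - k))"
      by (simp only: mult.assoc[symmetric] assms distrib_right)
    ultimately show "t * (c n k * (a k * t ^ (n - k))) = c n k * (a k * t ^ (Suc n - k)) +
        c n k * of_nat (Suc k) * (a (Suc k) * t ^ (n - k))"
      by (simp only: comm distrib_left mult.assoc)
  qed
  also have "(\<Sum>k\<le>n. c n k * (a k * t ^ (Suc n - k))) =
      (\<Sum>k\<le>Suc n. c n k * (a k * t ^ (Suc n - k)))"
    by (simp add: c_def binomial_eq_0)
  also have "\<dots> = a 0 * t ^ Suc n + (\<Sum>k\<le>n. c n (Suc k) * (a (Suc k) * t ^ (n - k)))"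
    by (subst sum.atMost_Suc_shift) (simp add: c_def)
  also have "\<dots> + (\<Sum>k\<le>n. c n k * of_nat (Suc k) * (a (Suc k) * t ^ (n - k))) =
      a 0 * t ^ Suc n + (\<Sum>k\<le>n. c (Suc n) (Suc k) * (a (Suc k) * t ^ (n - k)))"
    by (simp add: c_Suc distrib_right sum.distrib add.assoc del: of_nat_Suc)
  also have "\<dots> = (\<Sum>k\<le>Suc n. c (Suc n) k * (a k * t ^ (Suc n - k)))"
    by (subst sum.atMost_Suc_shift) (simp add: c_def)
  finally show ?case by (simp only: c_def)
qed simp

text \<open>For k > 0 the coefficient is the falling factorial p (p - 1) ... (p - k + 1), which
  contains the factor p; only the term k = 0 survives.\<close>

lemma power_CHAR_commute_iterated_commutator:
  fixes t :: "'r::ring_1" and a :: "nat \<Rightarrow> 'r"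
  assumes "\<And>k. t * a k = a k * t + of_nat (Suc k) * a (Suc k)"
    and "of_nat p = (0::'r)" and "p > 0"
  shows "t ^ p * a 0 = a 0 * t ^ p"
proof -
  have "of_nat ((p choose k) * fact k) = (0::'r)" if "k > 0" for k
  proof -
    have "(p choose k) * fact k = p * ((p - 1 choose (k - 1)) * fact (k - 1))"
      using times_binomial_minus1_eq[OF that, of p] fact_reduce[OF that, where 'a=nat]
      by (metis mult.assoc mult.commute of_nat_id)
    then have "of_nat ((p choose k) * fact k) =
        of_nat p * (of_nat ((p - 1 choose (k - 1)) * fact (k - 1)) :: 'r)"
      by (simp only: of_nat_mult[symmetric])
    then show ?thesis using assms(2) by simp
  qed
  then have "(\<Sum>k\<le>p. of_nat ((p choose k) * fact k) * (a k * t ^ (p - k))) =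
      (\<Sum>k\<in>{0}. of_nat ((p choose k) * fact k) * (a k * t ^ (p - k)))"
    by (intro sum.mono_neutral_right) (auto simp del: of_nat_mult)
  then show ?thesis
    by (simp add: power_mult_iterated_commutator[OF assms(1)])
qed

lemma sj_x_s_power: "sj_x * sj_s ^ n = sj_s ^ n * (sj_x :: 'k::field super_jordan)"
  by (metis power_commuting_commutes sj_x_s)

lemma sj_y_s_power:
  "sj_y * sj_s ^ n = sj_s ^ n * sj_y + of_nat n * (sj_s ^ n * sj_x :: 'k::field super_jordan)"
proof (induction n)
  case (Suc n)
  have "sj_y * sj_s ^ Suc n = (sj_y * sj_s ^ n) * (sj_s :: 'k super_jordan)"
    by (simp add: power_commutes mult.assoc)
  also have "\<dots> = sj_s ^ n * (sj_y * sj_s) + of_nat n * (sj_s ^ n * (sj_x * sj_s))"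
    by (simp add: Suc.IH distrib_right mult.assoc)
  also have "\<dots> = sj_s ^ n * sj_s * (sj_y + sj_x) + of_nat n * (sj_s ^ n * sj_s * sj_x)"
    by (simp add: sj_y_s sj_x_s mult.assoc)
  finally show ?case
    by (simp add: power_commutes algebra_simps)
qed simp

lemma sj_t_s_power:
  "sj_t * sj_s ^ n = sj_s ^ n * sj_t + of_nat n * (sj_s ^ Suc n :: 'k::field super_jordan)"
proof (induction n)
  case (Suc n)
  have "sj_t * sj_s ^ Suc n = (sj_t * sj_s ^ n) * (sj_s :: 'k super_jordan)"
    by (simp add: power_commutes mult.assoc)
  also have "\<dots> = sj_s ^ n * (sj_t * sj_s) + of_nat n * (sj_s ^ Suc n * sj_s)"
    by (simp add: Suc.IH distrib_right mult.assoc del: power_Suc)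
  also have "\<dots> = sj_s ^ n * sj_s * sj_t + sj_s ^ n * sj_s * sj_s + of_nat n * (sj_s ^ Suc n * sj_s)"
    by (simp add: sj_t_s distrib_left mult.assoc)
  finally show ?case
    by (simp add: power_commutes algebra_simps)
qed simp

lemma super_jordan_central:
  fixes c :: "'k::field super_jordan"
  assumes "c * sj_x = sj_x * c" "c * sj_y = sj_y * c"
  shows "c * a = a * c"
proof (induction a rule: super_jordan_induct)
  case (const d a)
  then show ?case by (metis mult.assoc sj_const_commute)
next
  case (x a)
  then show ?case by (metis mult.assoc assms(1))
next
  case (y a)
  then show ?case by (metis mult.assoc assms(2))
qed (simp_all add: distrib_left distrib_right)

lemma of_nat_CHAR_super_jordan: "of_nat CHAR('k) = (0 :: 'k::field super_jordan)"
  by (metis of_nat_CHAR sj_const_0 sj_const_of_nat)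

lemma sj_s_power_CHAR_central:
  "sj_s ^ CHAR('k) * a = a * (sj_s ^ CHAR('k) :: 'k::field super_jordan)"
  by (rule super_jordan_central) (simp_all add: sj_x_s_power sj_y_s_power of_nat_CHAR_super_jordan)

lemma sj_t_power_CHAR_central:
  assumes "CHAR('k) > 0"
  shows "sj_t ^ CHAR('k) * a = a * (sj_t ^ CHAR('k) :: 'k::field super_jordan)"
proof (rule super_jordan_central)
  \<comment> \<open>The sequence of commutators starting at x is x s^k: the factor x contributes one
    copy of x s^(k+1), the factor s^k contributes k of them.\<close>
  have "sj_t * (sj_x * sj_s ^ k) = sj_x * sj_s ^ k * sj_t +
      of_nat (Suc k) * (sj_x * sj_s ^ Suc k :: 'k super_jordan)" for k
  proof -
    have "sj_t * (sj_x * sj_s ^ k) = sj_x * (sj_t * sj_s ^ k) + (sj_x * sj_s ^ Suc k :: 'k super_jordan)"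
      by (simp only: mult.assoc[symmetric] sj_t_x) (simp add: distrib_left distrib_right mult.assoc)
    also have "sj_x * (sj_t * sj_s ^ k) = sj_x * sj_s ^ k * sj_t + of_nat k * (sj_x * sj_s ^ Suc k :: 'k super_jordan)"
      by (simp add: sj_t_s_power distrib_left mult.assoc del: power_Suc)
        (metis mult.assoc mult_of_nat_commute)
    finally show ?thesis by (simp add: algebra_simps)
  qed
  from power_CHAR_commute_iterated_commutator[of sj_t "\<lambda>k. sj_x * sj_s ^ k", OF this
      of_nat_CHAR_super_jordan assms]
  show "sj_t ^ CHAR('k) * sj_x = sj_x * (sj_t ^ CHAR('k) :: 'k super_jordan)" by simp
  show "sj_t ^ CHAR('k) * sj_y = sj_y * (sj_t ^ CHAR('k) :: 'k super_jordan)"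
    by (metis power_commuting_commutes sj_t_y)
qed

text \<open>The Frobenius identity is proved in the commutative ring k[X] and carried over by
  evaluation at \<open>a\<close>.\<close>

lemma sj_power_CHAR_diff:
  assumes "CHAR('k::field) > 0"
  shows "(a - sj_const c) ^ CHAR('k) = a ^ CHAR('k) - sj_const (c ^ CHAR('k) :: 'k)"
proof -
  have pr: "prime CHAR('k poly)" using assms prime_CHAR_semidom by simp
  have "([:-c, 1:] :: 'k poly) = monom 1 1 + [:-c:]"
    by (simp add: monom_altdef)
  then have "[:-c, 1:] ^ CHAR('k) = monom 1 1 ^ CHAR('k) + [:-c:] ^ CHAR('k)"
    using freshmans_dream[OF pr refl, of "monom 1 1" "[:-c:]"] by simp
  also have "[:-c:] ^ CHAR('k) = - [: c ^ CHAR('k) :]"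
    using minus_power_prime_CHAR[OF refl, of "c"] pr
    by (simp add: poly_const_pow)
  finally have "sj_eval ([:-c, 1:] ^ CHAR('k)) a = sj_eval (monom 1 1 ^ CHAR('k) + - [: c ^ CHAR('k) :]) a"
    by simp
  then show ?thesis
    by (simp add: sj_eval_power sj_eval_add sj_const_uminus)
qed

subsection \<open>Left ideals\<close>

definition is_left_ideal :: "'r::ring_1 set \<Rightarrow> bool" where
  "is_left_ideal L \<longleftrightarrow> 0 \<in> L \<and> (\<forall>a\<in>L. \<forall>b\<in>L. a + b \<in> L) \<and> (\<forall>a. \<forall>b\<in>L. a * b \<in> L)"

definition maximal_left_ideal :: "'r::ring_1 set \<Rightarrow> bool" where
  "maximal_left_ideal L \<longleftrightarrow> is_left_ideal L \<and> 1 \<notin> L \<and>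
     (\<forall>K. is_left_ideal K \<longrightarrow> L \<subseteq> K \<longrightarrow> K = L \<or> 1 \<in> K)"

context
  fixes L :: "'r::ring_1 set"
  assumes L: "is_left_ideal L"
begin

lemma left_ideal_0: "0 \<in> L"
  and left_ideal_add: "a \<in> L \<Longrightarrow> b \<in> L \<Longrightarrow> a + b \<in> L"
  and left_ideal_mult: "b \<in> L \<Longrightarrow> a * b \<in> L"
  using L by (auto simp: is_left_ideal_def)

lemma left_ideal_uminus: "a \<in> L \<Longrightarrow> - a \<in> L"
  using left_ideal_mult[of a "- 1"] by simp

lemma left_ideal_diff: "a \<in> L \<Longrightarrow> b \<in> L \<Longrightarrow> a - b \<in> L"
  using left_ideal_add[of a "- b"] left_ideal_uminus[of b] by simp

lemma left_ideal_diff_iff1: "a - b \<in> L \<Longrightarrow> a \<in> L \<longleftrightarrow> b \<in> L"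
  using left_ideal_add[of "a - b" b] left_ideal_diff[of a "a - b"] by auto

lemma left_ideal_trans: "a - b \<in> L \<Longrightarrow> b - c \<in> L \<Longrightarrow> a - c \<in> L"
  using left_ideal_add[of "a - b" "b - c"] by simp

text \<open>The set is the annihilator of the class of \<open>u\<close> in the quotient by L; using
  it in place of L means taking \<open>u\<close> as the base vector.\<close>

lemma left_ideal_colon: "is_left_ideal {a. a * u \<in> L}"
  by (auto simp: is_left_ideal_def distrib_right mult.assoc
      intro: left_ideal_0 left_ideal_add left_ideal_mult)

lemma left_ideal_sum_principal: "is_left_ideal {c * b + l | c l. l \<in> L}"
proof (unfold is_left_ideal_def, intro conjI allI ballI)
  show "0 \<in> {c * b + l | c l. l \<in> L}"
    using left_ideal_0 by (auto intro!: exI[of _ 0])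
next
  fix u v
  assume "u \<in> {c * b + l | c l. l \<in> L}" "v \<in> {c * b + l | c l. l \<in> L}"
  then obtain c l d m where "u = c * b + l" "v = d * b + m" "l \<in> L" "m \<in> L" by blast
  then have "u + v = (c + d) * b + (l + m)" "l + m \<in> L"
    by (auto simp: distrib_right left_ideal_add)
  then show "u + v \<in> {c * b + l | c l. l \<in> L}" by blast
next
  fix a v
  assume "v \<in> {c * b + l | c l. l \<in> L}"
  then obtain d m where "v = d * b + m" "m \<in> L" by blast
  then have "a * v = (a * d) * b + a * m" "a * m \<in> L"
    by (auto simp: distrib_left mult.assoc left_ideal_mult)
  then show "a * v \<in> {c * b + l | c l. l \<in> L}" by blast
qed

end

lemma maximal_left_idealD:
  assumes "maximal_left_ideal L"
  shows "is_left_ideal L" "1 \<notin> L"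
  using assms by (auto simp: maximal_left_ideal_def)

text \<open>The multiples of \<open>b\<close> together with L form a left ideal strictly above L, so
  it contains 1. This is the working form of simplicity: every nonzero vector of the quotient is
  cyclic.\<close>

lemma maximal_left_ideal_ex:
  assumes "maximal_left_ideal L" "b \<notin> L"
  shows "\<exists>c. a - c * b \<in> L"
proof -
  note L = maximal_left_idealD(1)[OF assms(1)]
  let ?K = "{c * b + l | c l. l \<in> L}"
  have "L \<subseteq> ?K" by (force intro: exI[of _ 0])
  moreover have "b = 1 * b + 0" by simp
  then have "b \<in> ?K" using left_ideal_0[OF L] by blast
  moreover have "is_left_ideal K \<Longrightarrow> L \<subseteq> K \<Longrightarrow> b \<in> K \<Longrightarrow> 1 \<in> K" for K
    using assms unfolding maximal_left_ideal_def by blast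
  ultimately have "1 \<in> ?K"
    using left_ideal_sum_principal[OF L, of b] by meson
  then obtain c l where "1 = c * b + l" "l \<in> L" by blast
  then have "a - (a * c) * b = a * l" by (metis add_diff_cancel_left' distrib_left mult.assoc mult.right_neutral)
  then show ?thesis using left_ideal_mult[OF L \<open>l \<in> L\<close>] by metis
qed

lemma maximal_left_idealI:
  assumes "is_left_ideal L" "1 \<notin> L" "\<And>b. b \<notin> L \<Longrightarrow> \<exists>c. 1 - c * b \<in> L"
  shows "maximal_left_ideal L"
  unfolding maximal_left_ideal_def
proof (intro conjI allI impI assms(1,2))
  fix K
  assume K: "is_left_ideal K" "L \<subseteq> K"
  show "K = L \<or> 1 \<in> K"
  proof (rule disjCI)
    assume "1 \<notin> K"
    have "b \<in> L" if "b \<in> K" for b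
    proof (rule ccontr)
      assume "b \<notin> L"
      then obtain c where "1 - c * b \<in> K" using assms(3) K(2) by blast
      with \<open>1 \<notin> K\<close> that show False
        using left_ideal_diff_iff1[OF K(1)] left_ideal_mult[OF K(1)] by blast
    qed
    with K(2) show "K = L" by blast
  qed
qed

lemma maximal_left_ideal_colon:
  assumes "maximal_left_ideal L" "u \<notin> L"
  shows "maximal_left_ideal {a. a * u \<in> L}"
proof (rule maximal_left_idealI)
  show "is_left_ideal {a. a * u \<in> L}"
    by (rule left_ideal_colon[OF maximal_left_idealD(1)[OF assms(1)]])
  fix b
  assume "b \<notin> {a. a * u \<in> L}"
  then obtain c where "u - c * (b * u) \<in> L"
    using maximal_left_ideal_ex[OF assms(1)] by blast
  then have "(1 - c * b) * u \<in> L" by (simp add: algebra_simps)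
  then show "\<exists>c. 1 - c * b \<in> {a. a * u \<in> L}" by blast
qed (use assms in simp)

lemma maximal_left_ideal_eqI:
  assumes "maximal_left_ideal L" "maximal_left_ideal K" "L \<subseteq> K"
  shows "L = K"
  using assms unfolding maximal_left_ideal_def by metis

text \<open>Schur's lemma in elementary form: if 1 = d u modulo L and c is central, then c = c d u =
  d c u.\<close>

lemma maximal_left_ideal_central:
  assumes L: "maximal_left_ideal L" and central: "\<And>a. c * a = a * c"
    and "u \<notin> L" "c * u \<in> L"
  shows "c \<in> L"
proof -
  note L' = maximal_left_idealD(1)[OF L]
  obtain d where d: "1 - d * u \<in> L" using maximal_left_ideal_ex[OF L \<open>u \<notin> L\<close>] by blast
  have "c = c * (1 - d * u) + d * (c * u)"
    by (simp add: algebra_simps) (metis central mult.assoc)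
  then show ?thesis
    using left_ideal_add[OF L' left_ideal_mult[OF L' d, of c] left_ideal_mult[OF L' assms(4), of d]]
    by simp
qed

lemma left_ideal_const:
  assumes "is_left_ideal L" "c \<noteq> 0" "sj_const c * u \<in> L"
  shows "u \<in> (L :: 'k::field super_jordan set)"
proof -
  have "sj_const (inverse c) * (sj_const c * u) = u"
    using assms(2) by (simp add: mult.assoc[symmetric] sj_const_mult[symmetric])
  with left_ideal_mult[OF assms(1,3)] show ?thesis by metis
qed

text \<open>Linear factors are split off \<open>f\<close> one at a time. If f = (X - c) h, then
  either h(a) u is nonzero modulo L and is an eigenvector, or h has smaller degree and still kills
  u.\<close>

lemma left_ideal_eigenvector:
  fixes a u :: "'k::alg_closed_field super_jordan"
  assumes L: "is_left_ideal L" and "u \<notin> L"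
    and "f \<noteq> 0" "sj_eval f a * u \<in> L"
  shows "\<exists>g c. sj_eval g a * u \<notin> L \<and> (a - sj_const c) * (sj_eval g a * u) \<in> L"
  using assms(3,4)
proof (induction "degree f" arbitrary: f)
  case 0
  then obtain d where "f = [:d:]" "d \<noteq> 0" by (metis degree_eq_zeroE pCons_0_0)
  with 0 left_ideal_const[OF L] \<open>u \<notin> L\<close> show ?case by auto
next
  case (Suc n)
  obtain c where "poly f c = 0"
    using alg_closed_imp_poly_has_root[of f] Suc.hyps(2) by auto
  then obtain h where f: "f = [:-c, 1:] * h"
    by (metis dvdE poly_eq_0_iff_dvd)
  with Suc.prems have "h \<noteq> 0" by auto
  with Suc.hyps(2) have "n = degree h" unfolding f by (subst (asm) degree_mult_eq) auto
  have "sj_eval f a * u = (a - sj_const c) * (sj_eval h a * u)"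
    unfolding f sj_eval_mult by (simp add: sj_const_uminus mult.assoc)
  then show ?case
    using Suc.hyps(1)[OF \<open>n = degree h\<close> \<open>h \<noteq> 0\<close>] Suc.prems(2) by (metis (no_types))
qed

section \<open>Moving x and powers of s past polynomials in t\<close>

lemma sj_eval_semicommute:
  assumes "b * a = a' * b"
  shows "b * sj_eval f a = sj_eval f a' * b"
proof (induction f)
  case (pCons c f)
  have "b * (a * sj_eval f a) = a' * sj_eval f a' * b"
    by (metis assms mult.assoc pCons.IH)
  then show ?case
    by (simp add: distrib_left distrib_right sj_const_commute)
qed simp

lemma sj_x_t: "sj_x * sj_t = (sj_t - sj_s) * (sj_x :: 'k::field super_jordan)"
  using sj_t_x[where 'k='k] by (simp add: algebra_simps sj_x_s)

lemma sj_x_eval_t: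
  "sj_x * sj_eval f sj_t = sj_eval f (sj_t - sj_s) * (sj_x :: 'k::field super_jordan)"
  by (rule sj_eval_semicommute[OF sj_x_t])

lemma sj_x_y_left: "sj_x * (sj_y * a) = sj_s * a - sj_y * (sj_x * (a :: 'k::field super_jordan))"
  by (simp add: mult.assoc[symmetric] sj_x_y left_diff_distrib)

lemma sj_s_t_left:
  "sj_s * (sj_t * a) = sj_t * (sj_s * a) - sj_s * (sj_s * (a :: 'k::field super_jordan))"
  by (simp add: mult.assoc[symmetric] sj_t_s distrib_right)

lemma sj_s_power_t:
  assumes "CHAR('k) > 0"
  shows "sj_s ^ (CHAR('k) - 1) * sj_t =
    sj_t * sj_s ^ (CHAR('k) - 1) + (sj_s ^ CHAR('k) :: 'k::field super_jordan)"
proof -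
  have "of_nat (CHAR('k) - 1) = (of_nat CHAR('k) - 1 :: 'k super_jordan)"
    using assms by (simp add: of_nat_diff)
  moreover have "Suc (CHAR('k) - 1) = CHAR('k)" using assms by simp
  ultimately show ?thesis
    using sj_t_s_power[of "CHAR('k) - 1", where 'k='k]
    by (simp del: power_Suc add: of_nat_CHAR_super_jordan)
qed

text \<open>The commutator of s^(p-1) with t is s^p, because p - 1 = -1 in k. Since s^p is central,
  commuting with s^(p-1) is the derivation s^p d/dt on k[t].\<close>

lemma sj_s_power_eval_t:
  assumes "CHAR('k) > 0"
  shows "sj_s ^ (CHAR('k) - 1) * sj_eval f sj_t = sj_eval f sj_t * sj_s ^ (CHAR('k) - 1) +
    sj_eval (pderiv f) sj_t * (sj_s ^ CHAR('k) :: 'k::field super_jordan)"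
proof (induction f)
  case (pCons c f)
  let ?u = "sj_s ^ (CHAR('k) - 1) :: 'k super_jordan" and ?z = "sj_s ^ CHAR('k) :: 'k super_jordan"
  have "?u * (sj_t * sj_eval f sj_t) = sj_t * (?u * sj_eval f sj_t) + ?z * sj_eval f sj_t"
    by (simp only: mult.assoc[symmetric] sj_s_power_t[OF assms] distrib_right)
  also have "?z * sj_eval f sj_t = sj_eval f sj_t * ?z"
    by (rule sj_s_power_CHAR_central)
  finally show ?case
    by (simp add: pCons.IH pderiv_pCons sj_eval_add distrib_left distrib_right mult.assoc
        sj_const_commute del: One_nat_def)
qed simp

text \<open>The class of 1 is killed by x and is an eigenvector of s. Properness of L and \<alpha>
  \<noteq> 0 are imposed lemma by lemma, so that the locale covers \<open>V_ideal\<close> as well as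
  an arbitrary left ideal above it.\<close>

locale sj_vacuum =
  fixes L :: "'k::field super_jordan set" and \<alpha> :: 'k
  assumes left_ideal: "is_left_ideal L"
    and x_mem: "sj_x \<in> L" and s_mem: "sj_s - sj_const \<alpha> \<in> L"
begin

lemma s_power_mem: "sj_s ^ n - sj_const (\<alpha> ^ n) \<in> L"
proof (induction n)
  case (Suc n)
  have "sj_const (\<alpha> ^ Suc n) = sj_const (\<alpha> ^ n) * sj_const \<alpha>"
    by (simp add: sj_const_mult[symmetric] mult.commute)
  then have "sj_s ^ Suc n - sj_const (\<alpha> ^ Suc n) =
      sj_s * (sj_s ^ n - sj_const (\<alpha> ^ n)) + sj_const (\<alpha> ^ n) * (sj_s - sj_const \<alpha>)"
    by (simp add: right_diff_distrib sj_const_commute[of sj_s])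
  then show ?case
    by (metis Suc.IH left_ideal left_ideal_add left_ideal_mult s_mem)
qed (simp add: left_ideal left_ideal_0)

text \<open>A power of s on the far right stands next to the base vector, where it acts as the
  scalar \<alpha>^n.\<close>

lemma mult_s_power_mem: "a * sj_s ^ n - sj_const (\<alpha> ^ n) * a \<in> L"
  using left_ideal_mult[OF left_ideal s_power_mem[of n], of a]
  by (simp add: right_diff_distrib sj_const_commute)

lemma mult_s_power_mem_iff: "a * sj_s ^ n \<in> L \<longleftrightarrow> sj_const (\<alpha> ^ n) * a \<in> L"
  by (rule left_ideal_diff_iff1[OF left_ideal]) (rule mult_s_power_mem)

lemma x_eval_t_mem: "sj_x * sj_eval f sj_t \<in> L"
  by (simp add: sj_x_eval_t left_ideal_mult[OF left_ideal x_mem])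

text \<open>From s t = (t - s) s one gets s (t h) = t (s h) - s (s h), so a polynomial of lower
  degree is reduced twice, h to g and then g to g'. Inducting on a bound for the degree makes the
  second reduction available.\<close>

lemma s_eval_t_reduce:
  assumes "degree f \<le> n"
  shows "\<exists>g. degree g \<le> n \<and> sj_s * sj_eval f sj_t - sj_eval g sj_t \<in> L"
  using assms
proof (induction n arbitrary: f)
  case 0
  then obtain c where f: "f = [:c:]" by (metis degree_eq_zeroE le_zero_eq)
  have "sj_s * sj_eval f sj_t - sj_eval [:\<alpha> * c:] sj_t = sj_const c * (sj_s - sj_const \<alpha>)"
    by (simp add: f sj_const_commute[of sj_s] sj_const_mult[symmetric] right_diff_distrib mult.commute)
  then show ?case
    by (metis degree_pCons_0 le_zero_eq left_ideal left_ideal_mult s_mem)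
next
  case (Suc n)
  obtain c h where f: "f = pCons c h" by (cases f)
  with Suc.prems have "degree h \<le> n" by (cases "h = 0") auto
  then obtain g where g: "degree g \<le> n" "sj_s * sj_eval h sj_t - sj_eval g sj_t \<in> L"
    using Suc.IH by blast
  then obtain g' where g': "degree g' \<le> n" "sj_s * sj_eval g sj_t - sj_eval g' sj_t \<in> L"
    using Suc.IH by blast
  have "sj_s * sj_eval f sj_t - sj_eval (pCons (\<alpha> * c) g - g') sj_t =
      sj_const c * (sj_s - sj_const \<alpha>) + (sj_t - sj_s) * (sj_s * sj_eval h sj_t - sj_eval g sj_t)
      - (sj_s * sj_eval g sj_t - sj_eval g' sj_t)"
    using sj_const_mult[of c \<alpha>]
    by (simp add: f sj_eval_diff sj_s_t_left sj_const_commute[of sj_s] algebra_simps)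
  also have "\<dots> \<in> L"
    by (intro left_ideal_add[OF left_ideal] left_ideal_diff[OF left_ideal]
        left_ideal_mult[OF left_ideal] g g' s_mem)
  finally have "sj_s * sj_eval f sj_t - sj_eval (pCons (\<alpha> * c) g - g') sj_t \<in> L" .
  moreover have "degree (pCons (\<alpha> * c) g - g') \<le> Suc n"
    using g(1) g'(1) by (intro degree_diff_le) (auto simp: degree_pCons_eq_if)
  ultimately show ?case by blast
qed

text \<open>The span of all f(t) and y g(t) is stable modulo L. Multiplication by y swaps the two
  parts up to a factor t; multiplication by x kills f(t) and, by x y = s - y x, sends y g(t) to s
  g(t), which is again a polynomial in t.\<close>

lemma normal_form: "\<exists>f g. b - (sj_eval f sj_t + sj_y * sj_eval g sj_t) \<in> L"
proof (induction b rule: super_jordan_induct)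
  case one
  have "1 - (sj_eval 1 sj_t + sj_y * sj_eval 0 sj_t) \<in> L"
    by (simp add: left_ideal left_ideal_0)
  then show ?case by blast
next
  case (const c b)
  then obtain f g where "b - (sj_eval f sj_t + sj_y * sj_eval g sj_t) \<in> L" by blast
  from left_ideal_mult[OF left_ideal this, of "sj_const c"]
  have "sj_const c * b - (sj_eval (Polynomial.smult c f) sj_t +
      sj_y * sj_eval (Polynomial.smult c g) sj_t) \<in> L"
    by (simp add: sj_eval_smult right_diff_distrib distrib_left)
      (metis mult.assoc sj_const_commute)
  then show ?case by blast
next
  case (x b)
  then obtain f g where *: "b - (sj_eval f sj_t + sj_y * sj_eval g sj_t) \<in> L" by blast
  obtain h where h: "sj_s * sj_eval g sj_t - sj_eval h sj_t \<in> L"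
    using s_eval_t_reduce[of g, OF order_refl] by blast
  have "sj_x * b - (sj_eval h sj_t + sj_y * sj_eval 0 sj_t) =
      sj_x * (b - (sj_eval f sj_t + sj_y * sj_eval g sj_t)) + sj_x * sj_eval f sj_t
      - sj_y * (sj_x * sj_eval g sj_t) + (sj_s * sj_eval g sj_t - sj_eval h sj_t)"
    by (simp add: right_diff_distrib distrib_left sj_x_y_left)
  also have "\<dots> \<in> L"
    by (intro left_ideal_add[OF left_ideal] left_ideal_diff[OF left_ideal]
        left_ideal_mult[OF left_ideal] * h x_eval_t_mem)
  finally show ?case by blast
next
  case (y b)
  then obtain f g where "b - (sj_eval f sj_t + sj_y * sj_eval g sj_t) \<in> L" by blast
  from left_ideal_mult[OF left_ideal this, of sj_y]
  have "sj_y * b - (sj_eval (pCons 0 g) sj_t + sj_y * sj_eval f sj_t) \<in> L"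
    by (simp add: right_diff_distrib distrib_left mult.assoc sj_t_def algebra_simps)
  then show ?case by blast
next
  case (add a b)
  then obtain f g f' g' where "a - (sj_eval f sj_t + sj_y * sj_eval g sj_t) \<in> L"
    "b - (sj_eval f' sj_t + sj_y * sj_eval g' sj_t) \<in> L" by blast
  from left_ideal_add[OF left_ideal this]
  have "a + b - (sj_eval (f + f') sj_t + sj_y * sj_eval (g + g') sj_t) \<in> L"
    by (simp add: sj_eval_add algebra_simps)
  then show ?case by blast
qed

lemma normal_form_reduced:
  assumes p: "CHAR('k) > 0" and t: "sj_t ^ CHAR('k) - sj_const \<beta> \<in> L"
  shows "\<exists>f g. degree f < CHAR('k) \<and> degree g < CHAR('k) \<and>
    b - (sj_eval f sj_t + sj_y * sj_eval g sj_t) \<in> L"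
proof -
  let ?m = "monom 1 CHAR('k) + [:- \<beta>:] :: 'k poly"
  have deg: "degree ?m = CHAR('k)"
    using p by (subst degree_add_eq_left) (simp_all add: degree_monom_eq)
  \<comment> \<open>Reduction modulo X^p - \<beta> is legitimate in a left ideal because the
    multiple of t^p - \<beta> can be written with that factor on the right.\<close>
  have red: "sj_eval f sj_t - sj_eval (f mod ?m) sj_t \<in> L" for f
  proof -
    have "sj_eval f sj_t - sj_eval (f mod ?m) sj_t = sj_eval (f div ?m * ?m) sj_t"
      by (simp add: sj_eval_diff[symmetric] minus_mod_eq_div_mult del: sj_eval_monom)
    also have "\<dots> = sj_eval (f div ?m) sj_t * (sj_t ^ CHAR('k) - sj_const \<beta>)"
      by (simp add: sj_eval_mult sj_eval_add sj_const_uminus)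
    finally show ?thesis by (simp add: left_ideal_mult[OF left_ideal t])
  qed
  have mod: "degree (f mod ?m) < CHAR('k)" for f
    using degree_mod_less[of ?m f] deg p by (metis degree_0 neq0_conv)
  obtain f g where fg: "b - (sj_eval f sj_t + sj_y * sj_eval g sj_t) \<in> L"
    using normal_form by blast
  have "b - (sj_eval (f mod ?m) sj_t + sj_y * sj_eval (g mod ?m) sj_t) =
      (b - (sj_eval f sj_t + sj_y * sj_eval g sj_t)) + (sj_eval f sj_t - sj_eval (f mod ?m) sj_t)
      + sj_y * (sj_eval g sj_t - sj_eval (g mod ?m) sj_t)"
    by (simp add: algebra_simps)
  also have "\<dots> \<in> L"
    by (intro left_ideal_add[OF left_ideal] left_ideal_mult[OF left_ideal] fg red)
  finally show ?thesis using mod by blast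
qed

text \<open>Since \<open>[s\<^sup>p\<^sup>-\<^sup>1, t] = s\<^sup>p\<close>, multiplication by \<open>s\<^sup>p\<^sup>-\<^sup>1\<close> acts modulo \<open>L\<close> on polynomials in \<open>t\<close>
  essentially as differentiation, so that a nonzero polynomial of degree less than \<open>p\<close> in \<open>L\<close>
  can be differentiated down to a nonzero constant.\<close>

lemma pderiv_t_mem:
  assumes p: "CHAR('k) > 0" and "\<alpha> \<noteq> 0" and "sj_eval f sj_t \<in> L"
  shows "sj_eval (pderiv f) sj_t \<in> L"
proof -
  let ?u = "sj_s ^ (CHAR('k) - 1) :: 'k super_jordan"
  have "sj_eval f sj_t * ?u \<in> L"
    using mult_s_power_mem[of "sj_eval f sj_t" "CHAR('k) - 1"] assms(3)
    by (metis left_ideal left_ideal_diff_iff1 left_ideal_mult)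
  moreover have "?u * sj_eval f sj_t \<in> L"
    using assms(3) by (simp add: left_ideal_mult[OF left_ideal])
  ultimately have "sj_eval (pderiv f) sj_t * sj_s ^ CHAR('k) \<in> L"
    using left_ideal_diff[OF left_ideal] sj_s_power_eval_t[OF p, of f]
    by (metis add_diff_cancel_left')
  then have "sj_const (\<alpha> ^ CHAR('k)) * sj_eval (pderiv f) sj_t \<in> L"
    by (simp only: mult_s_power_mem_iff)
  from left_ideal_const[OF left_ideal _ this] show ?thesis using \<open>\<alpha> \<noteq> 0\<close> by simp
qed

lemma eval_t_mem_imp_zero:
  assumes p: "CHAR('k) > 0" and "\<alpha> \<noteq> 0" and "1 \<notin> L"
    and "sj_eval f sj_t \<in> L" "degree f < CHAR('k)"
  shows "f = 0"
  using assms(4,5)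
proof (induction "degree f" arbitrary: f rule: less_induct)
  case less
  show ?case
  proof (cases "degree f")
    case 0
    then obtain c where f: "f = [:c:]" by (metis degree_eq_zeroE)
    have "c = 0"
      using left_ideal_const[OF left_ideal, of c 1] less.prems(1) \<open>1 \<notin> L\<close> by (auto simp: f)
    then show ?thesis by (simp add: f)
  next
    case (Suc n)
    have "coeff (pderiv f) n = of_nat (degree f) * lead_coeff f"
      by (simp add: coeff_pderiv Suc)
    \<comment> \<open>Here the bound degree < p enters: the exponent of the leading term is
      invertible in k, so the derivative does not vanish.\<close>
    moreover have "of_nat (degree f) \<noteq> (0 :: 'k)"
      using less.prems(2) Suc by (auto simp: of_nat_eq_0_iff_char_dvd simp del: of_nat_Suc dest: dvd_imp_le)
    moreover have "lead_coeff f \<noteq> 0"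
      using Suc by (metis degree_0 leading_coeff_0_iff nat.distinct(1))
    ultimately have "pderiv f \<noteq> 0" by auto
    moreover have "degree (pderiv f) \<le> n"
      by (intro degree_le allI impI) (simp add: coeff_pderiv coeff_eq_0 Suc)
    then have "degree (pderiv f) < degree f" by (simp add: Suc)
    ultimately show ?thesis
      using less.hyps[of "pderiv f"] pderiv_t_mem[OF p \<open>\<alpha> \<noteq> 0\<close> less.prems(1)] less.prems(2)
      by auto
  qed
qed

lemma normal_form_unique:
  assumes p: "CHAR('k) > 0" and "\<alpha> \<noteq> 0" and "1 \<notin> L"
    and fg: "sj_eval f sj_t + sj_y * sj_eval g sj_t \<in> L" "degree f < CHAR('k)" "degree g < CHAR('k)"
  shows "f = 0 \<and> g = 0"
proof -
  let ?u = "sj_s ^ (CHAR('k) - 1) :: 'k super_jordan"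
  have "?u * sj_s = sj_s ^ CHAR('k)"
    using p by (metis One_nat_def Suc_pred power_Suc2)
  \<comment> \<open>Applying s^(p-1) x to f(t) + y g(t) leaves s^p g(t). The central s^p can be
    moved to the right of g(t), where it becomes the nonzero scalar \<alpha>^p.\<close>
  then have "sj_eval g sj_t * sj_s ^ CHAR('k) = ?u * (sj_s * sj_eval g sj_t)"
    using sj_s_power_CHAR_central[of "sj_eval g sj_t"] by (metis mult.assoc)
  also have "\<dots> = ?u * (sj_x * (sj_eval f sj_t + sj_y * sj_eval g sj_t)
      - sj_x * sj_eval f sj_t + sj_y * (sj_x * sj_eval g sj_t))"
    by (simp add: distrib_left sj_x_y_left)
  also have "\<dots> \<in> L"
    by (intro left_ideal_add[OF left_ideal] left_ideal_diff[OF left_ideal]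
        left_ideal_mult[OF left_ideal] fg x_eval_t_mem)
  finally have "sj_const (\<alpha> ^ CHAR('k)) * sj_eval g sj_t \<in> L"
    by (simp only: mult_s_power_mem_iff)
  from left_ideal_const[OF left_ideal _ this] have "sj_eval g sj_t \<in> L"
    using \<open>\<alpha> \<noteq> 0\<close> by simp
  then have "g = 0" by (rule eval_t_mem_imp_zero[OF assms(1-3) _ fg(3)])
  then have "f = 0" using fg by (intro eval_t_mem_imp_zero[OF assms(1-3)]) auto
  with \<open>g = 0\<close> show ?thesis by simp
qed

end

subsection \<open>Representations\<close>

text \<open>Two operators satisfying the defining relations make the space a module over the
  algebra. The locale serves to prove left ideals proper, by evaluating a supposed expression for 1
  on a concrete vector.\<close>

locale sj_representation = vector_space scale
  for scale :: "'k::field \<Rightarrow> 'v::ab_group_add \<Rightarrow> 'v" +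
  fixes X Y :: "'v \<Rightarrow> 'v"
  assumes X_add: "X (u + v) = X u + X v" and X_scale: "X (scale c v) = scale c (X v)"
    and Y_add: "Y (u + v) = Y u + Y v" and Y_scale: "Y (scale c v) = scale c (Y v)"
    and X_X: "X (X v) = 0"
    and Y_Y_X: "Y (Y (X v)) = X (Y (Y v)) + X (Y (X v))"
begin

definition word_act :: "word \<Rightarrow> 'v \<Rightarrow> 'v" where
  "word_act w = foldr (\<lambda>g. case g of GX \<Rightarrow> X | GY \<Rightarrow> Y) (letters w)"

definition free_act :: "'k free_alg \<Rightarrow> 'v \<Rightarrow> 'v" where
  "free_act f v = (\<Sum>w\<in>Poly_Mapping.keys f. scale (Poly_Mapping.lookup f w) (word_act w v))"

lemma word_act_add: "word_act w (u + v) = word_act w u + word_act w v"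
proof -
  have "foldr (\<lambda>g. case g of GX \<Rightarrow> X | GY \<Rightarrow> Y) l (u + v) =
      foldr (\<lambda>g. case g of GX \<Rightarrow> X | GY \<Rightarrow> Y) l u + foldr (\<lambda>g. case g of GX \<Rightarrow> X | GY \<Rightarrow> Y) l v" for l
    by (induction l) (auto simp: X_add Y_add split: gen.split)
  then show ?thesis by (simp add: word_act_def)
qed

lemma word_act_scale: "word_act w (scale c v) = scale c (word_act w v)"
proof -
  have "foldr (\<lambda>g. case g of GX \<Rightarrow> X | GY \<Rightarrow> Y) l (scale c v) =
      scale c (foldr (\<lambda>g. case g of GX \<Rightarrow> X | GY \<Rightarrow> Y) l v)" for l
    by (induction l) (auto simp: X_scale Y_scale split: gen.split)
  then show ?thesis by (simp add: word_act_def)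
qed

lemma word_act_plus: "word_act (w + w') v = word_act w (word_act w' v)"
  by (simp add: word_act_def plus_word_def)

lemma free_act_superset:
  assumes "finite A" "Poly_Mapping.keys f \<subseteq> A"
  shows "free_act f v = (\<Sum>w\<in>A. scale (Poly_Mapping.lookup f w) (word_act w v))"
  unfolding free_act_def
  by (rule sum.mono_neutral_left[OF assms]) (auto simp: in_keys_iff)

lemma free_act_add: "free_act (f + g) v = free_act f v + free_act g v"
proof -
  let ?A = "Poly_Mapping.keys f \<union> Poly_Mapping.keys g"
  have "Poly_Mapping.keys (f + g) \<subseteq> ?A" by (rule keys_add)
  then show ?thesis
    by (simp add: free_act_superset[of ?A] lookup_add scale_left_distrib sum.distrib)
qed

lemma free_act_single: "free_act (Poly_Mapping.single w c) v = scale c (word_act w v)"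
  by (simp add: free_act_superset[of "{w}"])

lemma free_act_uminus: "free_act (- f) v = - free_act f v"
  using free_act_add[of f "- f" v] by (simp add: free_act_def[of 0] minus_unique)

lemma free_act_diff: "free_act (f - g) v = free_act f v - free_act g v"
  using free_act_add[of f "- g" v] by (simp add: free_act_uminus)

lemma free_act_add_right: "free_act f (u + v) = free_act f u + free_act f v"
  by (simp add: free_act_def word_act_add scale_right_distrib sum.distrib)

lemma free_act_0_right: "free_act f 0 = 0"
  using free_act_add_right[of f 0 0] by simp

lemma free_act_mult: "free_act (f * g) v = free_act f (free_act g v)"
proof (induction f rule: free_alg_induct)
  case (single w c)
  show ?case
    by (induction g rule: free_alg_induct)
      (simp_all add: mult_single free_act_single word_act_plus word_act_scale word_act_add
        distrib_left free_act_add scale_right_distrib)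
qed (simp add: distrib_right free_act_add)

text \<open>The elements acting as zero form a two-sided ideal containing both relations, hence the
  ideal generated by them.\<close>

lemma free_act_sj_ideal:
  assumes "f \<in> sj_ideal"
  shows "free_act f v = 0"
proof -
  let ?K = "{f. \<forall>v. free_act f v = 0}"
  have inv: "inv\<^bsub>add_monoid class_ring\<^esub> a = - a" for a :: "'k free_alg"
    unfolding a_inv_def[symmetric] by (simp add: class_ring_simps)
  have "ideal ?K class_ring"
  proof (rule idealI[OF ring_class_ring])
    show "subgroup ?K (add_monoid class_ring)"
      by (rule group.subgroupI[OF abelian_group.a_group[OF ring.is_abelian_group[OF ring_class_ring]]])
        (auto simp: free_act_add free_act_uminus inv[simplified] intro: exI[of _ 0] free_act_def[of 0, simplified])
  qed (auto simp: free_act_mult free_act_0_right)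
  moreover have "free_x ^ 2 \<in> ?K"
    "free_y ^ 2 * free_x - free_x * free_y ^ 2 - free_x * free_y * free_x \<in> ?K"
    by (simp_all add: free_act_mult free_act_diff power2_eq_square free_x_def free_y_def
        free_act_single word_act_def X_X Y_Y_X)
  ultimately show ?thesis
    using assms unfolding sj_ideal_def genideal_def by blast
qed

text \<open>The value is read off an arbitrarily chosen representative in the free algebra;
  independence of the choice is \<open>act_abs\<close>.\<close>

definition act :: "'k super_jordan \<Rightarrow> 'v \<Rightarrow> 'v" where
  "act a = free_act (SOME f. abs_super_jordan f = a)"

lemma act_abs: "act (abs_super_jordan f) v = free_act f v"
proof -
  define g where "g = (SOME g. abs_super_jordan g = abs_super_jordan f)"
  have "abs_super_jordan g = abs_super_jordan f"
    unfolding g_def by (rule someI[of _ f]) simp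
  then have "g - f \<in> sj_ideal" by (simp add: super_jordan.abs_eq_iff)
  from free_act_sj_ideal[OF this, of v] show ?thesis
    by (simp add: act_def g_def[symmetric] free_act_diff)
qed

lemma act_add: "act (a + b) v = act a v + act b v"
proof (induction a rule: super_jordan.abs_induct)
  case (1 f)
  show ?case
    by (induction b rule: super_jordan.abs_induct)
      (simp add: plus_super_jordan.abs_eq act_abs free_act_add)
qed

lemma act_mult: "act (a * b) v = act a (act b v)"
proof (induction a rule: super_jordan.abs_induct)
  case (1 f)
  show ?case
    by (induction b rule: super_jordan.abs_induct)
      (simp add: times_super_jordan.abs_eq act_abs free_act_mult)
qed

lemma act_x: "act sj_x v = X v"
  by (simp add: sj_x.abs_eq act_abs free_x_def free_act_single word_act_def)

lemma act_y: "act sj_y v = Y v"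
  by (simp add: sj_y.abs_eq act_abs free_y_def free_act_single word_act_def)

lemma act_const: "act (sj_const c) v = scale c v"
  by (simp add: sj_const.abs_eq act_abs free_const_def free_act_single word_act_def zero_word_def)

lemma act_1: "act 1 v = v"
  using act_const[of 1 v] by simp

lemma act_diff: "act (a - b) v = act a v - act b v"
  using act_add[of "a - b" b v] by simp

lemma act_0_right: "act a 0 = 0"
  by (simp add: act_def free_act_0_right)

lemma act_power: "act (a ^ n) v = (act a ^^ n) v"
  by (induction n) (simp_all add: act_1 act_mult)

end

subsection \<open>The left ideals defining the simple modules\<close>

lemma is_left_ideal_left_ideal3: "is_left_ideal (left_ideal3 a b c)"
  unfolding is_left_ideal_def left_ideal3_def
proof (intro conjI allI ballI)
  show "0 \<in> {f * a + g * b + h * c |f g h. True}"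
    by (auto intro!: exI[of _ 0])
next
  fix u v
  assume "u \<in> {f * a + g * b + h * c |f g h. True}" "v \<in> {f * a + g * b + h * c |f g h. True}"
  then obtain f g h f' g' h' where "u = f * a + g * b + h * c" "v = f' * a + g' * b + h' * c"
    by blast
  then have "u + v = (f + f') * a + (g + g') * b + (h + h') * c" by (simp add: algebra_simps)
  then show "u + v \<in> {f * a + g * b + h * c |f g h. True}" by blast
next
  fix d u
  assume "u \<in> {f * a + g * b + h * c |f g h. True}"
  then obtain f g h where "u = f * a + g * b + h * c" by blast
  then have "d * u = (d * f) * a + (d * g) * b + (d * h) * c" by (simp add: algebra_simps)
  then show "d * u \<in> {f * a + g * b + h * c |f g h. True}" by blast
qed

lemma left_ideal3_gens:
  "a \<in> left_ideal3 a b c" "b \<in> left_ideal3 a b c" "c \<in> left_ideal3 a b c"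
proof -
  have "a = 1 * a + 0 * b + 0 * c" "b = 0 * a + 1 * b + 0 * c" "c = 0 * a + 0 * b + 1 * c"
    by simp_all
  then show "a \<in> left_ideal3 a b c" "b \<in> left_ideal3 a b c" "c \<in> left_ideal3 a b c"
    unfolding left_ideal3_def by blast+
qed

lemma left_ideal3_subset:
  assumes "is_left_ideal L" "a \<in> L" "b \<in> L" "c \<in> L"
  shows "left_ideal3 a b c \<subseteq> L"
  using assms by (auto simp: left_ideal3_def intro!: left_ideal_add left_ideal_mult)

text \<open>A left ideal with the generators of the two-sided ideal in \<open>S_mod\<close>;
  \<open>S_ideal_eq\<close> shows that the two coincide.\<close>

definition S_ideal :: "'k::field \<Rightarrow> 'k super_jordan set" where
  "S_ideal \<alpha> = left_ideal3 sj_s sj_x (sj_y - sj_const \<alpha>)"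

definition V_ideal :: "nat \<Rightarrow> 'k::field \<Rightarrow> 'k \<Rightarrow> 'k super_jordan set" where
  "V_ideal p \<alpha> \<beta> = left_ideal3 sj_x (sj_s - sj_const \<alpha>) (sj_y ^ (2 * p) - sj_const \<beta>)"

lemma S_ideal_left: "is_left_ideal (S_ideal \<alpha>)"
  by (simp add: S_ideal_def is_left_ideal_left_ideal3)

lemma S_ideal_reduce: "\<exists>c. b - sj_const c \<in> S_ideal (\<alpha> :: 'k::field)"
proof (induction b rule: super_jordan_induct)
  case one
  show ?case by (rule exI[of _ 1]) (simp add: left_ideal_0[OF S_ideal_left])
next
  case (const d b)
  then obtain c where "b - sj_const c \<in> S_ideal \<alpha>" by blast
  from left_ideal_mult[OF S_ideal_left this, of "sj_const d"]
  show ?case by (auto simp: right_diff_distrib sj_const_mult[symmetric])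
next
  case (x b)
  then obtain c where c: "b - sj_const c \<in> S_ideal \<alpha>" by blast
  have "sj_x * b - sj_const 0 = sj_x * (b - sj_const c) + sj_const c * sj_x"
    by (simp add: right_diff_distrib sj_const_commute)
  also have "\<dots> \<in> S_ideal \<alpha>"
    using c left_ideal3_gens unfolding S_ideal_def
    by (intro left_ideal_add left_ideal_mult is_left_ideal_left_ideal3)
  finally show ?case by blast
next
  case (y b)
  then obtain c where c: "b - sj_const c \<in> S_ideal \<alpha>" by blast
  have "sj_y * b - sj_const (c * \<alpha>) = sj_y * (b - sj_const c) + sj_const c * (sj_y - sj_const \<alpha>)"
    by (simp add: right_diff_distrib sj_const_commute[of sj_y] sj_const_mult)
  also have "\<dots> \<in> S_ideal \<alpha>"
    using c left_ideal3_gens unfolding S_ideal_def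
    by (intro left_ideal_add left_ideal_mult is_left_ideal_left_ideal3)
  finally show ?case by blast
next
  case (add a b)
  then obtain c d where "a - sj_const c \<in> S_ideal \<alpha>" "b - sj_const d \<in> S_ideal \<alpha>" by blast
  from left_ideal_add[OF S_ideal_left this]
  have "a + b - sj_const (c + d) \<in> S_ideal \<alpha>" by (simp add: sj_const_add algebra_simps)
  then show ?case by blast
qed

lemma one_notin_S_ideal: "1 \<notin> S_ideal (\<alpha> :: 'k::field)"
proof
  \<comment> \<open>The character x -> 0, y -> \<alpha> kills all three generators but not
    1.\<close>
  interpret sj_representation "(*) :: 'k \<Rightarrow> 'k \<Rightarrow> 'k" "\<lambda>_. 0" "(*) \<alpha>"
    by unfold_locales (simp_all add: algebra_simps)
  assume "1 \<in> S_ideal \<alpha>"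
  then obtain f g h where "1 = f * sj_s + g * sj_x + h * (sj_y - sj_const \<alpha>)"
    unfolding S_ideal_def left_ideal3_def by blast
  then have "act 1 1 = act (f * sj_s + g * sj_x + h * (sj_y - sj_const \<alpha>)) 1" by simp
  then show False
    by (simp add: act_1 act_add act_mult act_diff act_x act_y act_const act_0_right sj_s_def)
qed

lemma S_ideal_maximal: "maximal_left_ideal (S_ideal \<alpha>)"
proof (rule maximal_left_idealI[OF S_ideal_left one_notin_S_ideal])
  fix b
  assume "b \<notin> S_ideal \<alpha>"
  obtain c where c: "b - sj_const c \<in> S_ideal \<alpha>" using S_ideal_reduce by blast
  with \<open>b \<notin> S_ideal \<alpha>\<close> have "c \<noteq> 0" by auto
  then have "1 - sj_const (inverse c) * b = - (sj_const (inverse c) * (b - sj_const c))"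
    by (simp add: right_diff_distrib sj_const_mult[symmetric])
  then show "\<exists>d. 1 - d * b \<in> S_ideal \<alpha>"
    using c S_ideal_left left_ideal_mult left_ideal_uminus by metis
qed

text \<open>Every \<open>b\<close> is a scalar c modulo the left ideal, so a b = a (b - c) + c a
  stays inside.\<close>

lemma S_ideal_right:
  assumes "a \<in> S_ideal \<alpha>"
  shows "a * b \<in> S_ideal \<alpha>"
proof -
  obtain c where c: "b - sj_const c \<in> S_ideal \<alpha>" using S_ideal_reduce by blast
  have "a * b = a * (b - sj_const c) + sj_const c * a"
    by (simp add: right_diff_distrib sj_const_commute)
  then show ?thesis
    using assms c S_ideal_left by (metis left_ideal_add left_ideal_mult)
qed

lemma S_ideal_eq: "Idl\<^bsub>SJ\<^esub> {sj_s, sj_x, sj_y - sj_const \<alpha>} = S_ideal (\<alpha> :: 'k::field)"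
proof
  let ?G = "{sj_s, sj_x, sj_y - sj_const \<alpha>}"
  note L = S_ideal_left[of \<alpha>]
  have inv: "inv\<^bsub>add_monoid class_ring\<^esub> a = - a" for a :: "'k super_jordan"
    unfolding a_inv_def[symmetric] by (simp add: class_ring_simps)
  have "ideal (S_ideal \<alpha>) SJ"
  proof (rule idealI[OF ring_class_ring])
    show "subgroup (S_ideal \<alpha>) (add_monoid SJ)"
      by (rule group.subgroupI[OF abelian_group.a_group[OF ring.is_abelian_group[OF ring_class_ring]]])
        (use L in \<open>auto simp: inv[simplified] left_ideal_add left_ideal_uminus dest: left_ideal_0\<close>)
  qed (use L in \<open>auto simp: left_ideal_mult S_ideal_right\<close>)
  then show "Idl\<^bsub>SJ\<^esub> ?G \<subseteq> S_ideal \<alpha>"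
    by (rule ring.genideal_minimal[OF ring_class_ring])
      (auto simp: S_ideal_def left_ideal3_gens)
  have I: "ideal (Idl\<^bsub>SJ\<^esub> ?G) SJ"
    by (rule ring.genideal_ideal[OF ring_class_ring]) simp
  have "is_left_ideal (Idl\<^bsub>SJ\<^esub> ?G)"
    unfolding is_left_ideal_def
    using additive_subgroup.zero_closed[OF ideal.axioms(1)[OF I]]
      additive_subgroup.a_closed[OF ideal.axioms(1)[OF I]] ideal.I_l_closed[OF I]
    by auto
  moreover have "?G \<subseteq> Idl\<^bsub>SJ\<^esub> ?G"
    by (rule ring.genideal_self[OF ring_class_ring]) simp
  ultimately show "S_ideal \<alpha> \<subseteq> Idl\<^bsub>SJ\<^esub> ?G"
    unfolding S_ideal_def by (intro left_ideal3_subset) auto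
qed

text \<open>On the cyclic vector killed by \<open>x\<close> with \<open>s\<close>-eigenvalue \<open>\<alpha>\<close> the operator \<open>s\<inverse>\<close> satisfies
  \<open>[s\<inverse>, t] = 1\<close>, so that on polynomials in \<open>t\<close> it becomes \<open>1/\<alpha> + d/dt\<close>.\<close>

definition inv_s_poly :: "'k::field \<Rightarrow> 'k poly \<Rightarrow> 'k poly" where
  "inv_s_poly \<alpha> f = Polynomial.smult (inverse \<alpha>) f + pderiv f"

lemma inv_s_poly_add: "inv_s_poly \<alpha> (f + g) = inv_s_poly \<alpha> f + inv_s_poly \<alpha> g"
  by (simp add: inv_s_poly_def pderiv_add smult_add_right algebra_simps)

lemma inv_s_poly_smult:
  "inv_s_poly \<alpha> (Polynomial.smult c f) = Polynomial.smult c (inv_s_poly \<alpha> f)"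
  by (simp add: inv_s_poly_def pderiv_smult smult_add_right mult.commute)

lemma inv_s_poly_mult:
  "inv_s_poly \<alpha> (f * g) = f * inv_s_poly \<alpha> g + pderiv f * g"
  by (simp add: inv_s_poly_def pderiv_mult algebra_simps)

text \<open>The operator is a nonzero scalar plus d/dt, which lowers degrees. If f/\<alpha> = - f',
  comparing degrees gives f = 0; and if g is a preimage of f', then \<alpha> (f - g) is a preimage
  of f.\<close>

lemma bij_inv_s_poly:
  assumes "(\<alpha> :: 'k::field) \<noteq> 0"
  shows "bij (inv_s_poly \<alpha>)"
proof (rule bijI)
  have degree: "pderiv f = 0 \<or> degree (pderiv f) < degree f" for f :: "'k poly"
  proof (cases "degree f")
    case 0
    then show ?thesis by (metis degree_eq_zeroE pderiv_singleton)
  next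
    case (Suc n)
    have "degree (pderiv f) \<le> n"
      by (intro degree_le allI impI) (simp add: coeff_pderiv coeff_eq_0 Suc)
    then show ?thesis by (simp add: Suc)
  qed
  show "inj (inv_s_poly \<alpha>)"
  proof (rule injI)
    fix f g
    assume eq: "inv_s_poly \<alpha> f = inv_s_poly \<alpha> g"
    have "inv_s_poly \<alpha> (f - g) = inv_s_poly \<alpha> f - inv_s_poly \<alpha> g"
      using inv_s_poly_add[of \<alpha> "f - g" g] by simp
    with eq have "Polynomial.smult (inverse \<alpha>) (f - g) = - pderiv (f - g)"
      by (simp add: inv_s_poly_def add_eq_0_iff2 del: pderiv_diff)
    moreover from this have "degree (f - g) = degree (pderiv (f - g))"
      using assms by (metis degree_minus degree_smult_eq inverse_nonzero_iff_nonzero)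
    ultimately show "f = g" using degree[of "f - g"] assms by auto
  qed
  have "\<exists>g. inv_s_poly \<alpha> g = f" for f
  proof (induction "degree f" arbitrary: f rule: less_induct)
    case less
    have "\<exists>g. inv_s_poly \<alpha> g = pderiv f"
    proof (cases "pderiv f = 0")
      case True
      then show ?thesis by (intro exI[of _ 0]) (simp add: inv_s_poly_def)
    next
      case False
      then show ?thesis using less degree by blast
    qed
    then obtain g where "inv_s_poly \<alpha> g = pderiv f" by blast
    then have "inv_s_poly \<alpha> (f - g) = Polynomial.smult (inverse \<alpha>) f"
      using inv_s_poly_add[of \<alpha> "f - g" g] by (simp add: inv_s_poly_def[of _ f])
    then have "inv_s_poly \<alpha> (Polynomial.smult \<alpha> (f - g)) = f"
      using assms by (simp add: inv_s_poly_smult)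
    then show ?case by blast
  qed
  then show "surj (inv_s_poly \<alpha>)" by (metis surjI)
qed

definition s_poly :: "'k::field \<Rightarrow> 'k poly \<Rightarrow> 'k poly" where
  "s_poly \<alpha> = inv_into UNIV (inv_s_poly \<alpha>)"

context
  fixes \<alpha> :: "'k::field"
  assumes \<alpha>: "\<alpha> \<noteq> 0"
begin

lemma s_poly_eqI: "inv_s_poly \<alpha> g = f \<Longrightarrow> s_poly \<alpha> f = g"
  using bij_inv_s_poly[OF \<alpha>] by (metis bij_inv_eq_iff s_poly_def)

lemma inv_s_poly_s_poly [simp]: "inv_s_poly \<alpha> (s_poly \<alpha> f) = f"
  using bij_inv_s_poly[OF \<alpha>] by (simp add: s_poly_def bij_is_surj surj_f_inv_f)

lemma s_poly_add: "s_poly \<alpha> (f + g) = s_poly \<alpha> f + s_poly \<alpha> g"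
  by (rule s_poly_eqI) (simp add: inv_s_poly_add)

lemma s_poly_smult: "s_poly \<alpha> (Polynomial.smult c f) = Polynomial.smult c (s_poly \<alpha> f)"
  by (rule s_poly_eqI) (simp add: inv_s_poly_smult)

lemma s_poly_1: "s_poly \<alpha> 1 = [:\<alpha>:]"
  by (rule s_poly_eqI) (use \<alpha> in \<open>simp add: inv_s_poly_def one_pCons\<close>)

text \<open>Multiplication by m commutes with d/dt when m' = 0. For m = t^p - \<beta> this makes the
  multiples of m stable under s.\<close>

lemma s_poly_mult_pderiv_0:
  "pderiv m = 0 \<Longrightarrow> s_poly \<alpha> (m * f) = m * s_poly \<alpha> f"
  by (rule s_poly_eqI) (simp add: inv_s_poly_mult)

text \<open>The operator form of t s = s t + s^2; applying the inverse of s to t (s f) gives t f + s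
  f by the product rule.\<close>

lemma s_poly_t:
  "[:0, 1:] * s_poly \<alpha> f = s_poly \<alpha> ([:0, 1:] * f) + s_poly \<alpha> (s_poly \<alpha> f)"
proof -
  have "s_poly \<alpha> ([:0, 1:] * f + s_poly \<alpha> f) = [:0, 1:] * s_poly \<alpha> f"
    by (rule s_poly_eqI) (simp add: inv_s_poly_mult pderiv_pCons del: mult_pCons_left)
  then show ?thesis by (simp only: s_poly_add)
qed

text \<open>The operators act on all pairs of polynomials, without reducing modulo m = t^p -
  \<beta>. The generators of the left ideal send (1, 0) to 0, 0 and (m, 0), and pairs of multiples
  of m are stable, so 1 in the ideal would give m dvd 1.\<close>

lemma one_notin_V_ideal:
  assumes p: "CHAR('k) = p" "p > 0"
  shows "1 \<notin> V_ideal p \<alpha> \<beta>"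
proof
  define t :: "'k poly" where "t = [:0, 1:]"
  define X :: "'k poly \<times> 'k poly \<Rightarrow> 'k poly \<times> 'k poly" where "X v = (s_poly \<alpha> (snd v), 0)" for v
  define Y :: "'k poly \<times> 'k poly \<Rightarrow> 'k poly \<times> 'k poly" where "Y v = (t * snd v, fst v)" for v
  define scale :: "'k \<Rightarrow> 'k poly \<times> 'k poly \<Rightarrow> 'k poly \<times> 'k poly" where
    "scale c v = (Polynomial.smult c (fst v), Polynomial.smult c (snd v))" for c v
  have s_poly_0: "s_poly \<alpha> 0 = 0" by (rule s_poly_eqI) (simp add: inv_s_poly_def)
  interpret sj_representation scale X Y
    by unfold_locales
      (auto simp: scale_def X_def Y_def s_poly_add s_poly_smult smult_add_right smult_add_left
        distrib_left s_poly_0 s_poly_t[folded t_def] zero_prod_def)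
  define m where "m = t ^ p - [:\<beta>:]"
  have fst_snd: "fst (X v) = s_poly \<alpha> (snd v)" "snd (X v) = 0"
    "fst (Y v) = t * snd v" "snd (Y v) = fst v"
    "fst (scale c v) = Polynomial.smult c (fst v)" "snd (scale c v) = Polynomial.smult c (snd v)"
    for v c by (simp_all add: X_def Y_def scale_def)
  have t_power: "t ^ n = monom 1 n" for n by (simp add: t_def monom_altdef)
  have "pderiv m = 0"
    using of_nat_CHAR[where 'a = 'k] p(1)
    by (simp add: m_def t_power pderiv_diff pderiv_monom)
  have invariant: "m dvd fst (act a v) \<and> m dvd snd (act a v)"
    if "m dvd fst v" "m dvd snd v" for a v
  proof (induction a rule: super_jordan_induct)
    case (x a)
    then obtain g where "snd (act a v) = m * g" by (auto elim: dvdE)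
    then show ?case
      by (simp add: act_mult act_x fst_snd s_poly_mult_pderiv_0 \<open>pderiv m = 0\<close>)
  qed (use that in \<open>auto simp: act_1 act_mult act_const act_add act_y fst_snd intro: dvd_smult\<close>)
  have Y_power: "(Y ^^ (2 * n)) (1, 0) = (t ^ n, 0)" for n
    by (induction n) (simp_all add: prod_eq_iff fst_snd)
  have Y: "act sj_y = Y" by (rule ext) (rule act_y)
  assume "1 \<in> V_ideal p \<alpha> \<beta>"
  then obtain f g h where
    "1 = f * sj_x + g * (sj_s - sj_const \<alpha>) + h * (sj_y ^ (2 * p) - sj_const \<beta>)"
    unfolding V_ideal_def left_ideal3_def by blast
  then have "act 1 (1, 0) =
      act (f * sj_x + g * (sj_s - sj_const \<alpha>) + h * (sj_y ^ (2 * p) - sj_const \<beta>)) (1, 0)"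
    by simp
  moreover have "act sj_x (1, 0) = 0" by (simp add: act_x prod_eq_iff fst_snd s_poly_0)
  moreover have "act (sj_s - sj_const \<alpha>) (1, 0) = 0"
    by (simp add: sj_s_def act_diff act_add act_mult act_x act_y act_const prod_eq_iff fst_snd
        s_poly_0 s_poly_1)
  moreover have "act (sj_y ^ (2 * p) - sj_const \<beta>) (1, 0) = (m, 0)"
    by (simp add: act_diff act_power Y Y_power act_const prod_eq_iff fst_snd m_def)
  ultimately have "(1, 0) = act h (m, 0)"
    by (simp add: act_1 act_add act_mult act_0_right)
  then have "m dvd 1" using invariant[of "(m, 0)" h] by (metis dvd_0_right dvd_refl fst_conv snd_conv)
  then have "degree m = 0" using dvd_imp_degree_le[of m 1] by simp
  moreover have "m = monom 1 p + [:- \<beta>:]" by (simp add: m_def t_power)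
  then have "degree m = p"
    using p by (simp add: degree_add_eq_left degree_monom_eq)
  ultimately show False using p by simp
qed

end

lemma V_ideal_vacuum:
  "is_left_ideal (V_ideal p \<alpha> \<beta>)" "sj_x \<in> V_ideal p \<alpha> \<beta>"
  "sj_s - sj_const \<alpha> \<in> V_ideal p \<alpha> \<beta>" "sj_t ^ p - sj_const \<beta> \<in> V_ideal p \<alpha> \<beta>"
  using left_ideal3_gens(3)[of "sj_y ^ (2 * p) - sj_const \<beta>"]
  by (auto simp: V_ideal_def is_left_ideal_left_ideal3 left_ideal3_gens sj_t_def power_mult power2_eq_square)

text \<open>Existence of the reduced form is applied modulo \<open>V_ideal\<close> and its
  uniqueness modulo a proper left ideal K above it. An element of K has a reduced form lying in K,
  so this form is zero and the element was already in \<open>V_ideal\<close>.\<close>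

lemma V_ideal_maximal:
  assumes p: "CHAR('k::field) = p" "p > 0" and \<alpha>: "(\<alpha> :: 'k) \<noteq> 0"
  shows "maximal_left_ideal (V_ideal p \<alpha> \<beta>)"
  unfolding maximal_left_ideal_def
proof (intro conjI allI impI V_ideal_vacuum one_notin_V_ideal[OF \<alpha> p])
  fix K
  assume K: "is_left_ideal K" "V_ideal p \<alpha> \<beta> \<subseteq> K"
  interpret V: sj_vacuum "V_ideal p \<alpha> \<beta>" \<alpha>
    by unfold_locales (rule V_ideal_vacuum)+
  interpret K: sj_vacuum K \<alpha>
    by unfold_locales (use K V_ideal_vacuum[where p = p and \<alpha> = \<alpha> and \<beta> = \<beta>] in blast)+
  show "K = V_ideal p \<alpha> \<beta> \<or> 1 \<in> K"
  proof (rule disjCI)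
    assume "1 \<notin> K"
    have "b \<in> V_ideal p \<alpha> \<beta>" if "b \<in> K" for b
    proof -
      obtain f g where fg: "degree f < p" "degree g < p"
        "b - (sj_eval f sj_t + sj_y * sj_eval g sj_t) \<in> V_ideal p \<alpha> \<beta>"
        using V.normal_form_reduced[unfolded p(1), OF p(2) V_ideal_vacuum(4), of b] by blast
      then have "sj_eval f sj_t + sj_y * sj_eval g sj_t \<in> K"
        using left_ideal_diff_iff1[OF K(1)] K(2) that by blast
      with fg(1,2) have "f = 0 \<and> g = 0"
        using K.normal_form_unique[of f g] p \<alpha> \<open>1 \<notin> K\<close> by simp
      with fg(3) show ?thesis by simp
    qed
    with K(2) show "K = V_ideal p \<alpha> \<beta>" by blast
  qed
qed

subsection \<open>Annihilators of eigenvectors\<close>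

text \<open>The kernel of s on the quotient is a submodule, because s moves to the right past each
  generator: s x = x s and s y = (y - x) s.\<close>

lemma left_ideal_s_kernel:
  assumes L: "is_left_ideal (L :: 'k::field super_jordan set)" and a: "sj_s * a \<in> L"
  shows "sj_s * (c * a) \<in> L"
proof (induction c rule: super_jordan_induct)
  case (const d c)
  have "sj_s * (sj_const d * c * a) = sj_const d * (sj_s * (c * a))"
    by (metis mult.assoc sj_const_commute)
  then show ?case using const by (simp add: left_ideal_mult[OF L])
next
  case (x c)
  have "sj_s * (sj_x * c * a) = sj_x * (sj_s * (c * a))"
    by (metis mult.assoc sj_x_s)
  then show ?case using x by (simp add: left_ideal_mult[OF L])
next
  case (y c)
  have "sj_s * (sj_y * c * a) = (sj_s * (sj_y + sj_x) - sj_s * sj_x) * (c * a)"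
    by (simp add: algebra_simps)
  also have "\<dots> = (sj_y - sj_x) * (sj_s * (c * a))"
    by (simp only: sj_y_s[symmetric] sj_x_s[symmetric]) (simp add: algebra_simps)
  finally show ?case using y by (simp add: left_ideal_mult[OF L])
qed (use a in \<open>simp_all add: distrib_left distrib_right left_ideal_add[OF L]\<close>)

lemma maximal_left_ideal_s_cases:
  assumes L: "maximal_left_ideal (L :: 'k::field super_jordan set)"
  shows "(\<forall>a. sj_s * a \<in> L) \<or> (\<forall>a. sj_s * a \<in> L \<longrightarrow> a \<in> L)"
proof (rule disjCI)
  note L' = maximal_left_idealD(1)[OF L]
  assume "\<not> (\<forall>a. sj_s * a \<in> L \<longrightarrow> a \<in> L)"
  then obtain a where a: "sj_s * a \<in> L" "a \<notin> L" by blast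
  show "\<forall>b. sj_s * b \<in> L"
  proof
    fix b
    obtain c where "b - c * a \<in> L" using maximal_left_ideal_ex[OF L a(2)] by blast
    then have "sj_s * (b - c * a) \<in> L" by (rule left_ideal_mult[OF L'])
    then show "sj_s * b \<in> L"
      using left_ideal_s_kernel[OF L' a(1), of c]
      by (simp add: right_diff_distrib left_ideal_diff_iff1[OF L'])
  qed
qed

text \<open>When s acts as zero, x y = - y x, so the kernel of x is a submodule; it is nonzero as
  x^2 = 0, hence x acts as zero too and only y remains. If y does not kill the class of 1, then 1 =
  c y for some c, and c y = y f(y) modulo L; the polynomial 1 - X f(X) has constant term 1 and kills
  the class of 1.\<close>

lemma S_ideal_annihilates:
  fixes L :: "'k::alg_closed_field super_jordan set"
  assumes L: "maximal_left_ideal L" and s: "\<And>a. sj_s * a \<in> L"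
  shows "\<exists>u \<alpha>. u \<notin> L \<and> S_ideal \<alpha> \<subseteq> {a. a * u \<in> L}"
proof -
  note L' = maximal_left_idealD(1)[OF L]
  have x_kernel: "sj_x * (c * a) \<in> L" if "sj_x * a \<in> L" for a c
  proof (induction c rule: super_jordan_induct)
    case (const d c)
    have "sj_x * (sj_const d * c * a) = sj_const d * (sj_x * (c * a))"
      by (metis mult.assoc sj_const_commute)
    then show ?case using const by (simp add: left_ideal_mult[OF L'])
  next
    case (y c)
    then show ?case
      by (simp add: mult.assoc sj_x_y_left left_ideal_diff[OF L'] left_ideal_mult[OF L'] s)
  qed (use that in \<open>simp_all add: distrib_left distrib_right mult.assoc left_ideal_add[OF L'] left_ideal_0[OF L']\<close>)
  have x: "sj_x * b \<in> L" for b
  proof -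
    obtain a where a: "a \<notin> L" "sj_x * a \<in> L"
    proof (cases "sj_x \<in> L")
      case True
      then show ?thesis using that[of 1] maximal_left_idealD(2)[OF L] by simp
    next
      case False
      then show ?thesis using that[of sj_x] by (simp add: left_ideal_0[OF L'])
    qed
    obtain c where "b - c * a \<in> L" using maximal_left_ideal_ex[OF L a(1)] by blast
    then have "sj_x * (b - c * a) \<in> L" by (rule left_ideal_mult[OF L'])
    then show ?thesis
      using x_kernel[OF a(2), of c] by (simp add: right_diff_distrib left_ideal_diff_iff1[OF L'])
  qed
  have "\<exists>f. f \<noteq> 0 \<and> sj_eval f sj_y \<in> L"
  proof (cases "sj_y \<in> L")
    case True
    then show ?thesis by (intro exI[of _ "[:0, 1:]"]) simp
  next
    case False
    have "\<exists>f. c * sj_y - sj_y * sj_eval f sj_y \<in> L" for c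
    proof (induction c rule: super_jordan_induct)
      case one
      show ?case by (rule exI[of _ 1]) (simp add: left_ideal_0[OF L'])
    next
      case (const d c)
      then obtain f where "c * sj_y - sj_y * sj_eval f sj_y \<in> L" by blast
      from left_ideal_mult[OF L' this, of "sj_const d"]
      have "sj_const d * c * sj_y - sj_y * sj_eval (Polynomial.smult d f) sj_y \<in> L"
        by (simp add: sj_eval_smult right_diff_distrib mult.assoc) (metis mult.assoc sj_const_commute)
      then show ?case by blast
    next
      case (x c)
      show ?case by (rule exI[of _ 0]) (simp add: x mult.assoc \<open>\<And>b. sj_x * b \<in> L\<close>)
    next
      case (y c)
      then obtain f where "c * sj_y - sj_y * sj_eval f sj_y \<in> L" by blast
      from left_ideal_mult[OF L' this, of sj_y]
      have "sj_y * c * sj_y - sj_y * sj_eval (pCons 0 f) sj_y \<in> L"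
        by (simp add: right_diff_distrib mult.assoc)
      then show ?case by blast
    next
      case (add a b)
      then obtain f g where "a * sj_y - sj_y * sj_eval f sj_y \<in> L" "b * sj_y - sj_y * sj_eval g sj_y \<in> L"
        by blast
      from left_ideal_add[OF L' this]
      have "(a + b) * sj_y - sj_y * sj_eval (f + g) sj_y \<in> L"
        by (simp add: sj_eval_add algebra_simps)
      then show ?case by blast
    qed
    moreover obtain c where "1 - c * sj_y \<in> L" using maximal_left_ideal_ex[OF L False] by blast
    ultimately obtain f where "1 - sj_y * sj_eval f sj_y \<in> L"
      using left_ideal_trans[OF L'] by blast
    then have "sj_eval (1 - pCons 0 f) sj_y \<in> L" by (simp add: sj_eval_diff)
    moreover have "coeff (1 - pCons 0 f) 0 \<noteq> 0" by simp
    then have "1 - pCons 0 f \<noteq> 0" by (metis coeff_0)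
    ultimately show ?thesis by blast
  qed
  then obtain g c where "sj_eval g sj_y * 1 \<notin> L" "(sj_y - sj_const c) * (sj_eval g sj_y * 1) \<in> L"
    using left_ideal_eigenvector[OF L' maximal_left_idealD(2)[OF L], of _ sj_y] by (metis mult.right_neutral)
  then show ?thesis
    unfolding S_ideal_def using left_ideal_colon[OF L'] s x
    by (intro exI[of _ "sj_eval g sj_y"] exI[of _ c] conjI left_ideal3_subset) auto
qed

section \<open>Polynomials annihilating a vector: eigenvectors of s and t\<close>

text \<open>The ordered expression sum f_i(s) t^i: the outer variable is t, the coefficients are
  polynomials in s written on the left. The map is linear over k[s] from the left but not
  multiplicative.\<close>

definition sj_eval2 :: "'k::field poly poly \<Rightarrow> 'k super_jordan" where
  "sj_eval2 P = fold_coeffs (\<lambda>f r. sj_eval f sj_s + r * sj_t) P 0"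

lemma sj_eval2_0 [simp]: "sj_eval2 0 = 0"
  by (simp add: sj_eval2_def)

lemma sj_eval2_pCons [simp]: "sj_eval2 (pCons f P) = sj_eval f sj_s + sj_eval2 P * sj_t"
  by (cases "f = 0 \<and> P = 0") (auto simp: sj_eval2_def)

lemma sj_eval2_add: "sj_eval2 (P + Q) = sj_eval2 P + sj_eval2 Q"
proof (induction P arbitrary: Q)
  case (pCons f P)
  show ?case
  proof (cases Q)
    fix g R
    assume "Q = pCons g R"
    then show ?thesis by (simp add: pCons.IH sj_eval_add distrib_right)
  qed
qed simp

lemma sj_eval2_smult: "sj_eval2 (Polynomial.smult f P) = sj_eval f sj_s * sj_eval2 P"
  by (induction P) (simp_all add: sj_eval_mult distrib_left mult.assoc)

lemma sj_eval2_uminus: "sj_eval2 (- P) = - sj_eval2 P"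
  using sj_eval2_add[of P "- P"] by (simp add: minus_unique)

lemma sj_eval2_diff: "sj_eval2 (P - Q) = sj_eval2 P - sj_eval2 Q"
  using sj_eval2_add[of P "- Q"] by (simp add: sj_eval2_uminus)

lemma sj_t_mult_eval2:
  "\<exists>P'. degree P' \<le> Suc (degree P) \<and> sj_t * sj_eval2 P = (sj_eval2 P' :: 'k::field super_jordan)"
proof (induction P)
  case 0
  show ?case by (intro exI[of _ 0]) simp
next
  case (pCons f P)
  then obtain P' where P': "degree P' \<le> Suc (degree P)" "sj_t * sj_eval2 P = sj_eval2 P'" by blast
  \<comment> \<open>The case split keeps the degree bound: for P = 0 the polynomial P' may have
    degree 1, one too many, while its value is 0 anyway.\<close>
  let ?R = "pCons (monom 1 2 * pderiv f) ([:f:] + (if P = 0 then 0 else P'))"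
  have "sj_t * sj_eval2 (pCons f P) = sj_eval2 ?R"
    using P'(2) by (auto simp: distrib_left distrib_right mult.assoc[symmetric] sj_t_eval_s sj_eval2_add)
  moreover have "degree ?R \<le> Suc (degree (pCons f P))"
    using P'(1) by (auto simp: degree_pCons_eq_if intro!: degree_add_le)
  ultimately show ?case by blast
qed

text \<open>The computation of \<open>sj_vacuum.normal_form\<close> with k[t] replaced by a space W
  that x kills and that s and t preserve; it applies while no eigenvector of s has been
  found.\<close>

lemma sj_vacuum_normal_form:
  fixes L :: "'k::field super_jordan set"
  assumes L: "is_left_ideal L" and x: "\<And>b. b \<in> W \<Longrightarrow> sj_x * b \<in> L"
    and "1 \<in> W" and add: "\<And>a b. a \<in> W \<Longrightarrow> b \<in> W \<Longrightarrow> a + b \<in> W"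
    and const: "\<And>c b. b \<in> W \<Longrightarrow> sj_const c * b \<in> W"
    and s: "\<And>b. b \<in> W \<Longrightarrow> sj_s * b \<in> W" and t: "\<And>b. b \<in> W \<Longrightarrow> sj_t * b \<in> W"
  shows "\<exists>v\<in>W. \<exists>w\<in>W. b - (v + sj_y * w) \<in> L"
proof (induction b rule: super_jordan_induct)
  case one
  have "0 \<in> W" using const[OF \<open>1 \<in> W\<close>, of 0] by simp
  with \<open>1 \<in> W\<close> show ?case by (intro bexI[of _ 1] bexI[of _ 0]) (simp_all add: left_ideal_0[OF L])
next
  case (const c b)
  then obtain v w where "v \<in> W" "w \<in> W" "b - (v + sj_y * w) \<in> L" by blast
  from left_ideal_mult[OF L this(3), of "sj_const c"]
  have "sj_const c * b - (sj_const c * v + sj_y * (sj_const c * w)) \<in> L"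
    by (simp add: right_diff_distrib distrib_left) (metis mult.assoc sj_const_commute)
  then show ?case using assms(5) \<open>v \<in> W\<close> \<open>w \<in> W\<close> by blast
next
  case (x b)
  then obtain v w where vw: "v \<in> W" "w \<in> W" "b - (v + sj_y * w) \<in> L" by blast
  have "sj_x * b - (sj_s * w + sj_y * 0) =
      sj_x * (b - (v + sj_y * w)) + sj_x * v - sj_y * (sj_x * w)"
    by (simp add: right_diff_distrib distrib_left sj_x_y_left)
  also have "\<dots> \<in> L"
    by (intro left_ideal_add[OF L] left_ideal_diff[OF L] left_ideal_mult[OF L] vw assms(2))
  finally show ?case
    using s[OF vw(2)] assms(5)[OF \<open>1 \<in> W\<close>, of 0]
    by (intro bexI[of _ "sj_s * w"] bexI[of _ 0]) simp_all
next
  case (y b)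
  then obtain v w where "v \<in> W" "w \<in> W" "b - (v + sj_y * w) \<in> L" by blast
  from left_ideal_mult[OF L this(3), of sj_y]
  have "sj_y * b - (sj_t * w + sj_y * v) \<in> L"
    by (simp add: sj_t_def algebra_simps)
  then show ?case using t \<open>v \<in> W\<close> \<open>w \<in> W\<close> by blast
next
  case (add a b)
  then obtain v w v' w' where "v \<in> W" "w \<in> W" "a - (v + sj_y * w) \<in> L"
    "v' \<in> W" "w' \<in> W" "b - (v' + sj_y * w') \<in> L" by blast
  moreover from left_ideal_add[OF L this(3,6)]
  have "a + b - ((v + v') + sj_y * (w + w')) \<in> L" by (simp add: algebra_simps)
  ultimately show ?case using assms(4) by blast
qed

text \<open>If the cyclic vector of \<open>J/L\<close> were not annihilated by any nonzero polynomial in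
  \<open>s\<close>, then all \<open>s\<^sup>p - \<gamma>\<close> would be invertible on \<open>J/L\<close>. Up to multiplication by powers of a
  fixed polynomial \<open>h(s)\<close>, the elements of \<open>W\<close> below have unique coordinates in \<open>A\<close>, and comparing
  the constant coordinate of \<open>1 = (s\<^sup>p - g\<^sup>p) u\<close> gives \<open>h(g) = 0\<close>.\<close>

lemma no_torsion_free_coordinates:
  fixes L :: "'k::field super_jordan set" and A :: "'k poly poly set"
  assumes p: "CHAR('k) > 0"
    and L: "maximal_left_ideal L" and x: "sj_x \<in> L" and s: "\<And>a. sj_s * a \<in> L \<Longrightarrow> a \<in> L"
    and free: "\<And>f. f \<noteq> 0 \<Longrightarrow> sj_eval f sj_s \<notin> L"
    and A_add: "\<And>P Q. P \<in> A \<Longrightarrow> Q \<in> A \<Longrightarrow> P + Q \<in> A"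
    and A_smult: "\<And>P f. P \<in> A \<Longrightarrow> Polynomial.smult f P \<in> A" and A_1: "1 \<in> A"
    and A_inj: "\<And>P. P \<in> A \<Longrightarrow> sj_eval2 P \<in> L \<Longrightarrow> P = 0"
    and A_t: "\<And>P. P \<in> A \<Longrightarrow>
      \<exists>k. \<exists>Q\<in>A. sj_eval (h ^ k) sj_s * (sj_t * sj_eval2 P) - sj_eval2 Q \<in> L"
  shows "poly h g = 0"
proof -
  note L' = maximal_left_idealD(1)[OF L]
  define E where "E f = sj_eval f (sj_s :: 'k super_jordan)" for f
  have E_mult: "E (f * g) = E f * E g" for f g
    by (simp add: E_def sj_eval_mult)
  have E_mult': "E (f * g) = E g * E f" for f g
    by (simp add: E_def sj_eval_mult')
  have A_diff: "P - Q \<in> A" if "P \<in> A" "Q \<in> A" for P Q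
    using A_add[OF that(1) A_smult[OF that(2), of "- 1"]] by simp
  \<comment> \<open>Elements with coordinates in \<open>A\<close> after clearing a denominator h^k,
    that is, after localization at h.\<close>
  define V where "V = {b. \<exists>k. \<exists>P\<in>A. E (h ^ k) * b - sj_eval2 P \<in> L}"
  define W where "W = V \<inter> {b. sj_x * b \<in> L}"
  have V_E: "E f * b \<in> V" if "b \<in> V" for f b
  proof -
    obtain k P where P: "P \<in> A" "E (h ^ k) * b - sj_eval2 P \<in> L" using \<open>b \<in> V\<close> V_def by blast
    have "E (h ^ k) * (E f * b) - sj_eval2 (Polynomial.smult f P) = E f * (E (h ^ k) * b - sj_eval2 P)"
      unfolding sj_eval2_smult by (simp add: right_diff_distrib mult.assoc[symmetric] E_def
          sj_eval_mult[symmetric] mult.commute)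
    also have "\<dots> \<in> L" by (rule left_ideal_mult[OF L' P(2)])
    finally show ?thesis using A_smult[OF P(1)] V_def by blast
  qed
  have V_add: "a + b \<in> V" if ab: "a \<in> V" "b \<in> V" for a b
  proof -
    obtain k P where P: "P \<in> A" "E (h ^ k) * a - sj_eval2 P \<in> L" using ab(1) V_def by blast
    obtain l Q where Q: "Q \<in> A" "E (h ^ l) * b - sj_eval2 Q \<in> L" using ab(2) V_def by blast
    have "E (h ^ (k + l)) * (a + b) -
        sj_eval2 (Polynomial.smult (h ^ l) P + Polynomial.smult (h ^ k) Q) =
        E (h ^ l) * (E (h ^ k) * a - sj_eval2 P) + E (h ^ k) * (E (h ^ l) * b - sj_eval2 Q)"
      unfolding sj_eval2_add sj_eval2_smult E_def[symmetric] power_add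
      using E_mult[of "h ^ k" "h ^ l"] E_mult'[of "h ^ k" "h ^ l"]
      by (simp add: algebra_simps) (metis mult.assoc)
    also have "\<dots> \<in> L" by (intro left_ideal_add[OF L'] left_ideal_mult[OF L'] P Q)
    finally show ?thesis using A_add[OF A_smult[OF P(1)] A_smult[OF Q(1)]] V_def by blast
  qed
  have V_t: "sj_t * b \<in> V" if "b \<in> V" for b
  proof -
    obtain k P where P: "P \<in> A" "E (h ^ k) * b - sj_eval2 P \<in> L" using \<open>b \<in> V\<close> V_def by blast
    obtain l Q where Q: "Q \<in> A"
      "E (h ^ l) * (sj_t * sj_eval2 (Polynomial.smult h P)) - sj_eval2 Q \<in> L"
      using A_t[OF A_smult[OF P(1)], of h] unfolding E_def by blast
    \<comment> \<open>Moving t past h^(k+1) costs s^2 (h^(k+1))', which still contains h^k; one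
      extra power of h therefore suffices to express the correction through the coordinates of
      \<open>b\<close>.\<close>
    define r where "r = monom 1 2 * pderiv (h ^ Suc k)"
    define r' where "r' = monom 1 2 * (Polynomial.smult (of_nat (Suc k)) (pderiv h))"
    have r: "r = r' * h ^ k"
      unfolding r_def r'_def pderiv_power_Suc by (simp add: mult.commute mult.left_commute)
    have "E (h ^ Suc k) * sj_t = sj_t * E (h ^ Suc k) - E r"
      unfolding E_def r_def by (simp only: sj_t_eval_s) simp
    then have *: "E (h ^ Suc k) * (sj_t * b) = sj_t * (E (h ^ Suc k) * b) - E r * b"
      by (metis left_diff_distrib mult.assoc)
    have "E (h ^ (l + Suc k)) * (sj_t * b) - sj_eval2 (Q - Polynomial.smult (h ^ l * r') P) =
        E (h ^ l) * (sj_t * (E h * (E (h ^ k) * b - sj_eval2 P))) +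
        (E (h ^ l) * (sj_t * sj_eval2 (Polynomial.smult h P)) - sj_eval2 Q)
        - E (h ^ l * r') * (E (h ^ k) * b - sj_eval2 P)"
      unfolding power_add E_mult mult.assoc * sj_eval2_diff sj_eval2_smult E_def[symmetric] r
      by (simp add: algebra_simps E_mult)
    also have "\<dots> \<in> L"
      by (intro left_ideal_add[OF L'] left_ideal_diff[OF L'] left_ideal_mult[OF L'] P Q)
    finally show ?thesis using A_diff[OF Q(1) A_smult[OF P(1)]] V_def by blast
  qed
  have W_E: "E f * b \<in> W" if "b \<in> W" for f b
  proof -
    have "sj_x * E f = E f * sj_x" unfolding E_def by (rule sj_eval_commute) (rule sj_x_s)
    then have "sj_x * (E f * b) = E f * (sj_x * b)" by (metis mult.assoc)
    with that show ?thesis by (simp add: W_def V_E left_ideal_mult[OF L'])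
  qed
  have W_t: "sj_t * b \<in> W" if "b \<in> W" for b
  proof -
    have "sj_x * (sj_t * b) = (sj_t - sj_s) * (sj_x * b)"
      by (metis mult.assoc sj_x_t)
    with that show ?thesis by (simp add: W_def V_t left_ideal_mult[OF L'])
  qed
  have "E (h ^ 0) * 1 - sj_eval2 1 = 0" by (simp add: one_pCons[where ?'a = "'k poly"] E_def)
  then have "1 \<in> W"
    unfolding W_def V_def using x A_1 left_ideal_0[OF L'] by (metis (mono_tags, lifting) CollectI IntI mult.right_neutral)
  have normal_form: "\<exists>v\<in>W. \<exists>w\<in>W. b - (v + sj_y * w) \<in> L" for b
  proof (rule sj_vacuum_normal_form[OF L' _ \<open>1 \<in> W\<close>])
    show "sj_const c * b \<in> W" if "b \<in> W" for c b
      using W_E[OF that, of "[:c:]"] by (simp add: E_def)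
    show "sj_s * b \<in> W" if "b \<in> W" for b
      using W_E[OF that, of "[:0, 1:]"] by (simp add: E_def)
    show "a + b \<in> W" if "a \<in> W" "b \<in> W" for a b
      using that by (auto simp: W_def V_add distrib_left left_ideal_add[OF L'])
  qed (auto simp: W_t, simp add: W_def)
  \<comment> \<open>A polynomial vanishing at g whose value at s is central, which is why p-th
    powers appear instead of s - g.\<close>
  define m where "m = monom 1 CHAR('k) - [:g ^ CHAR('k):]"
  have Em: "E m = sj_s ^ CHAR('k) - sj_const (g ^ CHAR('k))"
    by (simp add: E_def m_def sj_eval_diff)
  have central: "E m * a = a * E m" for a
    by (simp add: Em left_diff_distrib right_diff_distrib sj_s_power_CHAR_central sj_const_commute)
  have "coeff m CHAR('k) = 1" using p by (simp add: m_def coeff_pCons split: nat.split)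
  then have "E m \<notin> L" unfolding E_def by (intro free) auto
  then obtain c where "1 - c * E m \<in> L" using maximal_left_ideal_ex[OF L] by blast
  moreover obtain u w where u: "u \<in> W" and w: "w \<in> W" and "c - (u + sj_y * w) \<in> L"
    using normal_form by blast
  ultimately have "(1 - c * E m) + E m * (c - (u + sj_y * w)) \<in> L"
    by (intro left_ideal_add[OF L'] left_ideal_mult[OF L'])
  then have 1: "1 - E m * (u + sj_y * w) \<in> L"
    by (simp add: right_diff_distrib central)
  \<comment> \<open>Applying x removes the y-part of the inverse: the central \<open>E m\<close> can
    be cancelled, leaving x (u + y w) = s w = 0, and s is injective.\<close>
  have "sj_x * (1 - E m * (u + sj_y * w)) = sj_x - E m * (sj_x * (u + sj_y * w))"
    using central[of sj_x] by (simp add: right_diff_distrib) (metis mult.assoc)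
  with 1 have "sj_x - E m * (sj_x * (u + sj_y * w)) \<in> L"
    using left_ideal_mult[OF L'] by metis
  then have "E m * (sj_x * (u + sj_y * w)) \<in> L"
    using left_ideal_diff_iff1[OF L'] x by blast
  then have "sj_x * (u + sj_y * w) \<in> L"
    using maximal_left_ideal_central[OF L central] \<open>E m \<notin> L\<close> by blast
  then have "sj_x * (u + sj_y * w) - sj_x * u + sj_y * (sj_x * w) \<in> L"
    using u w left_ideal_mult[OF L', of "sj_x * w" sj_y]
    by (auto simp: W_def intro!: left_ideal_add[OF L'] left_ideal_diff[OF L'])
  then have "sj_s * w \<in> L" by (simp add: distrib_left sj_x_y_left)
  then have "w \<in> L" by (rule s)
  then have "(1 - E m * (u + sj_y * w)) + E m * (sj_y * w) \<in> L"
    by (intro left_ideal_add[OF L'] left_ideal_mult[OF L'] 1)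
  then have 2: "1 - E m * u \<in> L" by (simp add: distrib_left)
  obtain k P where P: "P \<in> A" "E (h ^ k) * u - sj_eval2 P \<in> L" using u W_def V_def by blast
  \<comment> \<open>Clearing the denominator in 1 = m u gives an identity of coordinates. Its
    constant term in t says that m divides h^k in k[s], and m vanishes at g.\<close>
  have "sj_eval2 (Polynomial.smult (h ^ k) 1 - Polynomial.smult m P) =
      E (h ^ k) * (1 - E m * u) + E m * (E (h ^ k) * u - sj_eval2 P)"
    unfolding sj_eval2_diff sj_eval2_smult E_def[symmetric]
    by (simp add: right_diff_distrib one_pCons[where ?'a = "'k poly"] E_def[of 1, simplified])
      (metis central mult.assoc)
  also have "\<dots> \<in> L"
    by (intro left_ideal_add[OF L'] left_ideal_mult[OF L'] P 2)
  finally have "Polynomial.smult (h ^ k) 1 - Polynomial.smult m P = 0"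
    by (intro A_inj A_diff A_smult A_1 P)
  then have "coeff (Polynomial.smult (h ^ k) 1 - Polynomial.smult m P) 0 = 0" by (simp only: coeff_0)
  then have "h ^ k = m * coeff P 0" by simp
  then have "poly h g ^ k = poly m g * poly (coeff P 0) g" by (metis poly_mult poly_power)
  also have "poly m g = 0" by (simp add: m_def poly_monom)
  finally show ?thesis by simp
qed

text \<open>A nonconstant h takes the value 1, because h - 1 has a root.\<close>

lemma ex_nonroot:
  assumes "h \<noteq> (0 :: 'k::alg_closed_field poly)"
  shows "\<exists>g. poly h g \<noteq> 0"
proof (cases "degree h")
  case 0
  then show ?thesis using assms by (auto elim!: degree_eq_zeroE)
next
  case (Suc n)
  have "degree (h + [:- 1:]) = degree h" by (rule degree_add_eq_left) (simp add: Suc)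
  then obtain g where "poly (h + [:- 1:]) g = 0"
    using alg_closed_imp_poly_has_root[of "h + [:- 1:]"] Suc by auto
  then have "poly h g = 1" by simp
  then show ?thesis by (metis zero_neq_one)
qed

text \<open>If the ordered monomials in s and t are independent over k[s] on the base vector, all
  polynomials serve as coordinates, with h = 1. Otherwise a relation Q of least degree n in t is
  taken; minimality makes the coordinates of degree below n unique, and n > 0 because no polynomial
  in s alone is a relation.\<close>

lemma ex_s_polynomial:
  fixes L :: "'k::alg_closed_field super_jordan set"
  assumes p: "CHAR('k) > 0"
    and L: "maximal_left_ideal L" and x: "sj_x \<in> L" and s: "\<And>a. sj_s * a \<in> L \<Longrightarrow> a \<in> L"
  shows "\<exists>f. f \<noteq> 0 \<and> sj_eval f sj_s \<in> L"
proof (rule ccontr)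
  note L' = maximal_left_idealD(1)[OF L]
  assume "\<not> ?thesis"
  then have free: "sj_eval f sj_s \<notin> L" if "f \<noteq> 0" for f using that by blast
  show False
  proof (cases "\<exists>Q. Q \<noteq> 0 \<and> sj_eval2 Q \<in> L")
    case False
    have "poly (1 :: 'k poly) 0 = 0"
    proof (rule no_torsion_free_coordinates[OF p L x s free, of UNIV])
      show "\<exists>k. \<exists>Q\<in>UNIV. sj_eval (1 ^ k) sj_s * (sj_t * sj_eval2 P) - sj_eval2 Q \<in> L" for P
        using sj_t_mult_eval2[of P] left_ideal_0[OF L'] by (metis UNIV_I diff_self mult_1 power_one sj_eval_1)
    qed (use False in auto)
    then show False by simp
  next
    case True
    then obtain Q where Q: "Q \<noteq> 0" "sj_eval2 Q \<in> L"
      and min: "\<And>P. P \<noteq> 0 \<Longrightarrow> sj_eval2 P \<in> L \<Longrightarrow> degree Q \<le> degree P"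
      using exists_least_iff[of "\<lambda>n. \<exists>Q. degree Q = n \<and> Q \<noteq> 0 \<and> sj_eval2 Q \<in> L"]
      by (metis not_le)
    define h n where "h = lead_coeff Q" and "n = degree Q"
    have "h \<noteq> 0" using Q by (simp add: h_def)
    have "n > 0"
    proof (rule ccontr)
      assume "\<not> n > 0"
      then have "Q = [:h:]" unfolding h_def n_def by (metis degree_eq_zeroE lead_coeff_pCons(2) neq0_conv)
      then show False using Q free[OF \<open>h \<noteq> 0\<close>] by simp
    qed
    obtain g where "poly h g \<noteq> 0" using ex_nonroot[OF \<open>h \<noteq> 0\<close>] by blast
    moreover have "poly h g = 0"
    proof (rule no_torsion_free_coordinates[OF p L x s free, of "{P. degree P < n}"])
      fix P :: "'k poly poly"
      assume "P \<in> {P. degree P < n}"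
      then obtain R where R: "degree R \<le> n" "sj_t * sj_eval2 P = sj_eval2 R"
        using sj_t_mult_eval2[of P] by (metis Suc_leI mem_Collect_eq order_trans)
      \<comment> \<open>Pseudo-division by Q: multiplying by its leading coefficient h lets the
        terms of degree n cancel.\<close>
      let ?R = "Polynomial.smult h R - Polynomial.smult (coeff R n) Q"
      have "coeff ?R i = 0" if "i \<ge> n" for i
        using that R(1) by (cases "i = n") (auto simp: h_def n_def coeff_eq_0)
      then have "degree ?R < n"
        using \<open>n > 0\<close> by (metis degree_0 leading_coeff_0_iff not_le)
      moreover have "sj_eval (h ^ 1) sj_s * (sj_t * sj_eval2 P) - sj_eval2 ?R =
          sj_eval (coeff R n) sj_s * sj_eval2 Q"
        by (simp add: R sj_eval2_diff sj_eval2_smult)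
      ultimately show "\<exists>k. \<exists>Q\<in>{P. degree P < n}.
          sj_eval (h ^ k) sj_s * (sj_t * sj_eval2 P) - sj_eval2 Q \<in> L"
        using left_ideal_mult[OF L' Q(2)] by (metis mem_Collect_eq)
    next
      fix P :: "'k poly poly" and f
      assume "P \<in> {P. degree P < n}"
      then show "Polynomial.smult f P \<in> {P. degree P < n}"
        using degree_smult_le[of f P] by simp
    next
      fix P :: "'k poly poly"
      assume "P \<in> {P. degree P < n}" "sj_eval2 P \<in> L"
      then show "P = 0" using min[of P] by (auto simp: n_def)
    qed (use \<open>n > 0\<close> in \<open>auto simp: degree_add_less\<close>)
    ultimately show False by blast
  qed
qed

text \<open>If T = t^p does not kill the base vector, it has an inverse there, and the normal form
  of the inverse gives 1 = T f(t) + y T g(t) modulo L. Applying x and using injectivity of s removes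
  the y-part, so 1 - t^p f(t) kills the vector; its constant term is 1.\<close>

lemma ex_t_polynomial:
  fixes L :: "'k::field super_jordan set"
  assumes p: "CHAR('k) > 0" and L: "maximal_left_ideal L" and s: "\<And>a. sj_s * a \<in> L \<Longrightarrow> a \<in> L"
    and vac: "sj_vacuum L \<alpha>"
  shows "\<exists>f. f \<noteq> 0 \<and> sj_eval f sj_t \<in> L"
proof -
  interpret sj_vacuum L \<alpha> by (rule vac)
  let ?m = "monom 1 CHAR('k) :: 'k poly"
  let ?T = "sj_t ^ CHAR('k) :: 'k super_jordan"
  show ?thesis
  proof (cases "?T \<in> L")
    case True
    then show ?thesis by (intro exI[of _ ?m]) simp
  next
    case False
    obtain c where c: "1 - c * ?T \<in> L" using maximal_left_ideal_ex[OF L False] by blast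
    obtain f g where fg: "c - (sj_eval f sj_t + sj_y * sj_eval g sj_t) \<in> L"
      using normal_form by blast
    have comm: "?T * (sj_eval f sj_t + sj_y * sj_eval g sj_t) =
        sj_eval (?m * f) sj_t + sj_y * sj_eval (?m * g) sj_t"
      using sj_t_power_CHAR_central[OF p, of sj_y]
      by (simp add: distrib_left sj_eval_mult) (metis mult.assoc)
    have "(1 - c * ?T) + ?T * (c - (sj_eval f sj_t + sj_y * sj_eval g sj_t)) \<in> L"
      by (intro left_ideal_add[OF left_ideal] left_ideal_mult[OF left_ideal] c fg)
    also have "(1 - c * ?T) + ?T * (c - (sj_eval f sj_t + sj_y * sj_eval g sj_t)) =
        1 - ?T * (sj_eval f sj_t + sj_y * sj_eval g sj_t)"
      by (simp add: right_diff_distrib sj_t_power_CHAR_central[OF p, of c])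
    finally have 1: "1 - (sj_eval (?m * f) sj_t + sj_y * sj_eval (?m * g) sj_t) \<in> L"
      by (simp only: comm)
    have "sj_s * sj_eval (?m * g) sj_t =
        - (sj_x * (1 - (sj_eval (?m * f) sj_t + sj_y * sj_eval (?m * g) sj_t))) + sj_x
        - sj_x * sj_eval (?m * f) sj_t + sj_y * (sj_x * sj_eval (?m * g) sj_t)"
      by (simp add: right_diff_distrib distrib_left sj_x_y_left)
    also have "\<dots> \<in> L"
      by (intro left_ideal_add[OF left_ideal] left_ideal_diff[OF left_ideal] left_ideal_uminus[OF left_ideal]
          left_ideal_mult[OF left_ideal 1] left_ideal_mult[OF left_ideal x_eval_t_mem] x_eval_t_mem x_mem)
    finally have "sj_eval (?m * g) sj_t \<in> L" by (rule s)
    then have "1 - (sj_eval (?m * f) sj_t + sj_y * sj_eval (?m * g) sj_t) + sj_y * sj_eval (?m * g) sj_t \<in> L"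
      by (intro left_ideal_add[OF left_ideal] left_ideal_mult[OF left_ideal] 1)
    then have "sj_eval (1 - ?m * f) sj_t \<in> L" by (simp add: sj_eval_diff)
    moreover have "coeff (1 - ?m * f) 0 \<noteq> 0" using p by (simp add: coeff_monom_mult)
    then have "1 - ?m * f \<noteq> 0" by (metis coeff_0)
    ultimately show ?thesis by blast
  qed
qed

text \<open>The base vector is changed twice, to a vector killed by x and then to an eigenvector of
  s. An eigenvector of t is used only to find \<beta>: as [t, s] = s^2 and s is injective, it cannot
  be an eigenvector of s as well.\<close>

lemma V_ideal_annihilates:
  fixes L :: "'k::alg_closed_field super_jordan set"
  assumes p: "CHAR('k) = p" "p > 0"
    and L: "maximal_left_ideal L" and s: "\<And>a. sj_s * a \<in> L \<Longrightarrow> a \<in> L"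
  shows "\<exists>u \<alpha> \<beta>. u \<notin> L \<and> \<alpha> \<noteq> 0 \<and> V_ideal p \<alpha> \<beta> \<subseteq> {a. a * u \<in> L}"
proof -
  have p': "CHAR('k) > 0" using p by simp
  note L' = maximal_left_idealD(1)[OF L]
  obtain u where u: "u \<notin> L" "sj_x * u \<in> L"
  proof (cases "sj_x \<in> L")
    case True
    then show ?thesis using that[of 1] maximal_left_idealD(2)[OF L] by simp
  next
    case False
    then show ?thesis using that[of sj_x] by (simp add: left_ideal_0[OF L'])
  qed
  define M where "M = {a. a * u \<in> L}"
  have M: "maximal_left_ideal M" unfolding M_def by (rule maximal_left_ideal_colon[OF L u(1)])
  note M' = maximal_left_idealD(1)[OF M]
  have "sj_x \<in> M" using u by (simp add: M_def)
  have Ms: "a \<in> M" if "sj_s * a \<in> M" for a using that s by (simp add: M_def mult.assoc)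
  obtain f where "f \<noteq> 0" "sj_eval f sj_s * 1 \<in> M"
    using ex_s_polynomial[OF p' M \<open>sj_x \<in> M\<close> Ms] by auto
  then obtain g \<alpha> where g: "sj_eval g sj_s * 1 \<notin> M" "(sj_s - sj_const \<alpha>) * (sj_eval g sj_s * 1) \<in> M"
    using left_ideal_eigenvector[OF M' maximal_left_idealD(2)[OF M]] by blast
  define w where "w = sj_eval g (sj_s :: 'k super_jordan)"
  have w: "w \<notin> M" "(sj_s - sj_const \<alpha>) * w \<in> M" using g by (simp_all add: w_def)
  have "\<alpha> \<noteq> 0" using w Ms by auto
  have "sj_x * w = w * sj_x" unfolding w_def by (rule sj_eval_commute[OF sj_x_s])
  with \<open>sj_x \<in> M\<close> have "sj_x * w \<in> M" by (simp add: left_ideal_mult[OF M'])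
  define N where "N = {a. a * w \<in> M}"
  have N: "maximal_left_ideal N" unfolding N_def by (rule maximal_left_ideal_colon[OF M w(1)])
  note N' = maximal_left_idealD(1)[OF N]
  have Ns: "a \<in> N" if "sj_s * a \<in> N" for a using that Ms by (simp add: N_def mult.assoc)
  have vac: "sj_vacuum N \<alpha>"
    by unfold_locales (use N' w \<open>sj_x * w \<in> M\<close> in \<open>auto simp: N_def\<close>)
  obtain f where "f \<noteq> 0" "sj_eval f sj_t * 1 \<in> N"
    using ex_t_polynomial[OF p' N Ns vac] by auto
  then obtain g' b where "sj_eval g' sj_t * 1 \<notin> N" "(sj_t - sj_const b) * (sj_eval g' sj_t * 1) \<in> N"
    using left_ideal_eigenvector[OF N' maximal_left_idealD(2)[OF N]] by blast
  \<comment> \<open>The central element (t - b)^p = t^p - b^p kills the eigenvector of t, hence the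
    whole module, so \<beta> = b^p.\<close>
  moreover have "(sj_t - sj_const b) ^ p * v \<in> N" if "(sj_t - sj_const b) * v \<in> N" for v
  proof -
    have "(sj_t - sj_const b) ^ p * v = (sj_t - sj_const b) ^ (p - 1) * ((sj_t - sj_const b) * v)"
      using p(2) by (metis Suc_diff_1 mult.assoc power_Suc2)
    then show ?thesis using that by (simp add: left_ideal_mult[OF N'])
  qed
  moreover have power: "(sj_t - sj_const b) ^ p = sj_t ^ p - sj_const (b ^ p)"
    using sj_power_CHAR_diff[OF p', of sj_t b] p(1) by simp
  moreover have "(sj_t - sj_const b) ^ p * a = a * (sj_t - sj_const b) ^ p" for a
    unfolding power using sj_t_power_CHAR_central[OF p', of a] p(1)
    by (simp add: left_diff_distrib right_diff_distrib sj_const_commute[of a])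
  ultimately have "sj_t ^ p - sj_const (b ^ p) \<in> N"
    using maximal_left_ideal_central[OF N] by metis
  then have "sj_y ^ (2 * p) - sj_const (b ^ p) \<in> N"
    by (simp add: power_mult sj_t_def power2_eq_square)
  then have "V_ideal p \<alpha> (b ^ p) \<subseteq> N"
    unfolding V_ideal_def using vac
    by (intro left_ideal3_subset) (auto simp: sj_vacuum_def)
  then have "V_ideal p \<alpha> (b ^ p) \<subseteq> {a. a * (w * u) \<in> L}"
    by (auto simp: N_def M_def mult.assoc)
  moreover have "w * u \<notin> L" using w by (simp add: M_def)
  ultimately show ?thesis using \<open>\<alpha> \<noteq> 0\<close> by blast
qed

theorem maximal_left_ideal_classification:
  fixes L :: "'k::alg_closed_field super_jordan set"
  assumes p: "CHAR('k) = p" "p > 0" and L: "maximal_left_ideal L"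
  shows "\<exists>u. u \<notin> L \<and> ((\<exists>\<alpha>. {a. a * u \<in> L} = S_ideal \<alpha>) \<or>
    (\<exists>\<alpha> \<beta>. \<alpha> \<noteq> 0 \<and> {a. a * u \<in> L} = V_ideal p \<alpha> \<beta>))"
proof -
  have eq: "{a. a * u \<in> L} = K" if "u \<notin> L" "maximal_left_ideal K" "K \<subseteq> {a. a * u \<in> L}" for u K
    using maximal_left_ideal_eqI[OF that(2) maximal_left_ideal_colon[OF L that(1)] that(3)] by simp
  from maximal_left_ideal_s_cases[OF L] show ?thesis
  proof
    assume "\<forall>a. sj_s * a \<in> L"
    then obtain u \<alpha> where "u \<notin> L" "S_ideal \<alpha> \<subseteq> {a. a * u \<in> L}"
      using S_ideal_annihilates[OF L] by blast
    with eq[OF _ S_ideal_maximal] show ?thesis by blast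
  next
    assume "\<forall>a. sj_s * a \<in> L \<longrightarrow> a \<in> L"
    then obtain u \<alpha> \<beta> where "u \<notin> L" "\<alpha> \<noteq> 0" "V_ideal p \<alpha> \<beta> \<subseteq> {a. a * u \<in> L}"
      using V_ideal_annihilates[OF p L] by blast
    with eq[OF _ V_ideal_maximal[OF p]] show ?thesis by blast
  qed
qed

subsection \<open>Quotients by left ideals as modules\<close>

definition coset :: "'r::ring_1 set \<Rightarrow> 'r \<Rightarrow> 'r set" where
  "coset L r = {a. a - r \<in> L}"

lemma a_r_coset_eq_coset: "L +>\<^bsub>class_ring\<^esub> r = coset L (r :: 'r::ring_1)"
proof -
  have "a - r \<in> L \<Longrightarrow> a \<in> (\<Union>h\<in>L. {h + r})" for a
    by (rule UN_I[of "a - r"]) simp_all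
  then show ?thesis by (auto simp: a_r_coset_def r_coset_def coset_def)
qed

context
  fixes L :: "'r::ring_1 set"
  assumes L: "is_left_ideal L"
begin

lemma coset_eq_iff: "coset L r = coset L s \<longleftrightarrow> r - s \<in> L"
proof
  assume "coset L r = coset L s"
  moreover have "r \<in> coset L r" by (simp add: coset_def left_ideal_0[OF L])
  ultimately have "r \<in> coset L s" by simp
  then show "r - s \<in> L" by (simp add: coset_def)
next
  assume "r - s \<in> L"
  moreover from left_ideal_uminus[OF L this] have "s - r \<in> L" by simp
  ultimately show "coset L r = coset L s"
    unfolding coset_def using left_ideal_trans[OF L] by blast
qed

lemma carrier_quot_module: "carrier (quot_module class_ring L) = range (coset L)"
  by (auto simp: quot_module_def A_RCOSETS_def' a_r_coset_eq_coset)

lemma zero_quot_module: "\<zero>\<^bsub>quot_module class_ring L\<^esub> = coset L 0"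
  by (simp add: quot_module_def coset_def)

lemma add_quot_module: "coset L r \<oplus>\<^bsub>quot_module class_ring L\<^esub> coset L s = coset L (r + s)"
proof -
  have "coset L r <+>\<^bsub>class_ring\<^esub> coset L s = coset L (r + s)"
  proof (rule Set.set_eqI)
    fix a
    have "a - s \<in> coset L r" "s \<in> coset L s" "a = (a - s) + s" if "a - (r + s) \<in> L"
      using that left_ideal_0[OF L] by (simp_all add: coset_def algebra_simps)
    moreover have "b + c - (r + s) \<in> L" if "b - r \<in> L" "c - s \<in> L" for b c
      using left_ideal_add[OF L that] by (simp add: algebra_simps)
    ultimately show "a \<in> coset L r <+>\<^bsub>class_ring\<^esub> coset L s \<longleftrightarrow> a \<in> coset L (r + s)"
      unfolding set_add_def set_mult_def by (auto simp: coset_def)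
  qed
  then show ?thesis by (simp add: quot_module_def)
qed

lemma smult_quot_module: "a \<odot>\<^bsub>quot_module class_ring L\<^esub> coset L r = coset L (a * r)"
proof -
  have eq: "coset L (a * b) = coset L (a * r)" if "b \<in> coset L r" for b
    using that left_ideal_mult[OF L, of "b - r" a]
    by (simp add: coset_eq_iff right_diff_distrib) (simp add: coset_def right_diff_distrib)
  have mem: "r \<in> coset L r" by (simp add: coset_def left_ideal_0[OF L])
  have "(\<Union>b\<in>coset L r. coset L (a * b)) = coset L (a * r)"
    by (rule UN_constant_eq[OF mem]) (simp add: eq)
  then show ?thesis by (simp add: quot_module_def a_r_coset_eq_coset)
qed

lemma left_module_quot_module: "left_module class_ring (quot_module class_ring L)"
proof -
  note simps = carrier_quot_module zero_quot_module add_quot_module smult_quot_module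
  have "abelian_group (quot_module class_ring L)"
  proof (rule abelian_groupI)
    fix u
    assume "u \<in> carrier (quot_module class_ring L)"
    then obtain r where "u = coset L r" by (auto simp: simps)
    then show "\<exists>v\<in>carrier (quot_module class_ring L).
        v \<oplus>\<^bsub>quot_module class_ring L\<^esub> u = \<zero>\<^bsub>quot_module class_ring L\<^esub>"
      by (intro bexI[of _ "coset L (- r)"]) (auto simp: simps)
  qed (auto simp: simps ac_simps)
  then show ?thesis
    by (auto simp: left_module_def left_module_axioms_def ring_class_ring simps
        distrib_left distrib_right mult.assoc)
qed

end

lemma submodule_class_ringI:
  assumes "N \<subseteq> carrier M" "\<zero>\<^bsub>M\<^esub> \<in> N"
    and "\<And>u v. u \<in> N \<Longrightarrow> v \<in> N \<Longrightarrow> u \<oplus>\<^bsub>M\<^esub> v \<in> N"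
    and smult: "\<And>a u. u \<in> N \<Longrightarrow> a \<odot>\<^bsub>M\<^esub> u \<in> N"
    and M: "left_module (class_ring :: 'r::ring_1 ring) M"
  shows "Module.submodule N (class_ring :: 'r ring) M"
proof -
  interpret left_module "class_ring :: 'r ring" M by (rule M)
  have minus: "\<ominus>\<^bsub>M\<^esub> u = (- 1) \<odot>\<^bsub>M\<^esub> u" if "u \<in> carrier M" for u
  proof -
    have "0 \<odot>\<^bsub>M\<^esub> u \<oplus>\<^bsub>M\<^esub> 0 \<odot>\<^bsub>M\<^esub> u = 0 \<odot>\<^bsub>M\<^esub> u"
      using smult_l_distr[of 0 0 u] that by simp
    then have zero: "0 \<odot>\<^bsub>M\<^esub> u = \<zero>\<^bsub>M\<^esub>"
      using smult_closed[of 0 u] that by (simp add: M.add.l_cancel_one)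
    have "(- 1) \<odot>\<^bsub>M\<^esub> u \<oplus>\<^bsub>M\<^esub> u = \<zero>\<^bsub>M\<^esub>"
      using smult_l_distr[of "- 1" 1 u] smult_one[OF that] that zero by simp
    then show ?thesis
      using that smult_closed[of "- 1" u] by (intro M.minus_equality) simp_all
  qed
  show ?thesis
    unfolding Module.submodule_def Module.submodule_axioms_def
  proof (intro conjI)
    show "subgroup N (add_monoid M)"
      by (rule M.add.subgroupI) (use assms(1-3) smult minus in \<open>auto simp flip: a_inv_def\<close>)
  qed (use smult in auto)
qed

lemma submoduleD:
  assumes "Module.submodule N (class_ring :: 'r::ring_1 ring) M"
  shows "N \<subseteq> carrier M" "\<zero>\<^bsub>M\<^esub> \<in> N" "u \<in> N \<Longrightarrow> v \<in> N \<Longrightarrow> u \<oplus>\<^bsub>M\<^esub> v \<in> N"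
    "u \<in> N \<Longrightarrow> a \<odot>\<^bsub>M\<^esub> u \<in> N"
proof -
  interpret Module.submodule N "class_ring :: 'r ring" M by (rule assms)
  show "N \<subseteq> carrier M" "\<zero>\<^bsub>M\<^esub> \<in> N" "u \<in> N \<Longrightarrow> v \<in> N \<Longrightarrow> u \<oplus>\<^bsub>M\<^esub> v \<in> N"
    "u \<in> N \<Longrightarrow> a \<odot>\<^bsub>M\<^esub> u \<in> N"
    using subset one_closed m_closed smult_closed by simp_all
qed

text \<open>The preimage of a submodule under the projection is a left ideal above L, so it is L
  itself or contains 1.\<close>

lemma simple_quot_module:
  assumes "maximal_left_ideal (L :: 'r::ring_1 set)"
  shows "simple_module class_ring (quot_module class_ring L)"
proof -
  note L = maximal_left_idealD(1)[OF assms]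
  let ?Q = "quot_module class_ring L"
  note simps = carrier_quot_module[OF L] zero_quot_module[OF L] add_quot_module[OF L] smult_quot_module[OF L]
  have "coset L 1 \<noteq> coset L 0"
    using maximal_left_idealD(2)[OF assms] by (simp add: coset_eq_iff[OF L])
  moreover have "N = {\<zero>\<^bsub>?Q\<^esub>} \<or> N = carrier ?Q" if "Module.submodule N class_ring ?Q" for N
  proof -
    note N = submoduleD[OF that]
    define K where "K = {a. coset L a \<in> N}"
    have K: "is_left_ideal K"
      unfolding is_left_ideal_def K_def
      using N(2-4) by (auto simp: simps(2) simps(3,4)[symmetric])
    have "L \<subseteq> K"
    proof
      fix a assume "a \<in> L"
      then have "coset L a = coset L 0" by (simp add: coset_eq_iff[OF L])
      with N(2) show "a \<in> K" by (simp add: K_def simps(2))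
    qed
    with assms K consider "K = L" | "1 \<in> K" by (auto simp: maximal_left_ideal_def)
    then show ?thesis
    proof cases
      case 1
      have "u = coset L 0" if u: "u \<in> N" for u
      proof -
        obtain a where a: "u = coset L a" using N(1) u by (auto simp: simps)
        then have "a \<in> K" using u by (simp add: K_def)
        with 1 show ?thesis by (simp add: a coset_eq_iff[OF L])
      qed
      with N(2) show ?thesis unfolding simps(2) by blast
    next
      case 2
      have "coset L a \<in> N" for a
        using left_ideal_mult[OF K 2, of a] by (simp add: K_def)
      with N(1) show ?thesis by (auto simp: simps(1))
    qed
  qed
  ultimately show ?thesis
    using left_module_quot_module[OF L] unfolding simple_module_def by (auto simp: simps(1,2))
qed

context
  fixes M :: "('r::ring_1, 'm, 'c) module_scheme"
  assumes M: "simple_module class_ring M"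
begin

interpretation M: left_module "class_ring :: 'r ring" M
  using M by (simp add: simple_module_def)

lemma smult_zero_left: "v \<in> carrier M \<Longrightarrow> 0 \<odot>\<^bsub>M\<^esub> v = \<zero>\<^bsub>M\<^esub>"
  using M.smult_l_distr[of 0 0 v] M.smult_closed[of 0 v] by (simp add: M.add.l_cancel_one)

lemma smult_zero_right: "a \<odot>\<^bsub>M\<^esub> \<zero>\<^bsub>M\<^esub> = \<zero>\<^bsub>M\<^esub>"
  using M.smult_r_distr[of a "\<zero>\<^bsub>M\<^esub>" "\<zero>\<^bsub>M\<^esub>"] M.smult_closed[of a "\<zero>\<^bsub>M\<^esub>"]
  by (simp add: M.add.l_cancel_one)

lemma smult_diff_zero_iff:
  assumes "v \<in> carrier M"
  shows "(a - b) \<odot>\<^bsub>M\<^esub> v = \<zero>\<^bsub>M\<^esub> \<longleftrightarrow> a \<odot>\<^bsub>M\<^esub> v = b \<odot>\<^bsub>M\<^esub> v"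
proof -
  have "a \<odot>\<^bsub>M\<^esub> v = (a - b) \<odot>\<^bsub>M\<^esub> v \<oplus>\<^bsub>M\<^esub> b \<odot>\<^bsub>M\<^esub> v"
    using M.smult_l_distr[of "a - b" b v] assms by simp
  then show ?thesis using assms M.smult_closed[of _ v] by (simp add: M.add.r_cancel_one)
qed

lemma simple_module_cyclic:
  assumes v: "v \<in> carrier M" "v \<noteq> \<zero>\<^bsub>M\<^esub>" and "u \<in> carrier M"
  shows "\<exists>c. u = c \<odot>\<^bsub>M\<^esub> v"
proof -
  let ?N = "range (\<lambda>c. c \<odot>\<^bsub>M\<^esub> v)"
  have "Module.submodule ?N class_ring M"
  proof (rule submodule_class_ringI[OF _ _ _ _ M.left_module_axioms])
    show "?N \<subseteq> carrier M" using M.smult_closed[OF _ v(1)] by auto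
    show "\<zero>\<^bsub>M\<^esub> \<in> ?N" using smult_zero_left[OF v(1)] by (metis rangeI)
    show "a \<oplus>\<^bsub>M\<^esub> b \<in> ?N" if ab: "a \<in> ?N" "b \<in> ?N" for a b
    proof -
      obtain c d where "a = c \<odot>\<^bsub>M\<^esub> v" "b = d \<odot>\<^bsub>M\<^esub> v" using ab by blast
      then have "a \<oplus>\<^bsub>M\<^esub> b = (c + d) \<odot>\<^bsub>M\<^esub> v" using M.smult_l_distr[of c d v] v(1) by simp
      then show ?thesis by blast
    qed
    show "a \<odot>\<^bsub>M\<^esub> w \<in> ?N" if w: "w \<in> ?N" for a w
    proof -
      obtain c where "w = c \<odot>\<^bsub>M\<^esub> v" using w by blast
      then have "a \<odot>\<^bsub>M\<^esub> w = (a * c) \<odot>\<^bsub>M\<^esub> v" using M.smult_assoc[of a c v] v(1) by simp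
      then show ?thesis by blast
    qed
  qed
  moreover have "v = 1 \<odot>\<^bsub>M\<^esub> v" using M.smult_one[OF v(1)] by simp
  then have "v \<in> ?N" by blast
  ultimately have "?N = carrier M"
    using M v(2) unfolding simple_module_def by blast
  with assms show ?thesis by blast
qed

lemma maximal_annihilator:
  assumes v: "v \<in> carrier M" "v \<noteq> \<zero>\<^bsub>M\<^esub>"
  shows "maximal_left_ideal {a. a \<odot>\<^bsub>M\<^esub> v = \<zero>\<^bsub>M\<^esub>}"
proof (rule maximal_left_idealI)
  show "is_left_ideal {a. a \<odot>\<^bsub>M\<^esub> v = \<zero>\<^bsub>M\<^esub>}"
    using M.smult_l_distr[of _ _ v] M.smult_assoc[of _ _ v] v(1)
    by (auto simp: is_left_ideal_def smult_zero_left smult_zero_right)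
  show "1 \<notin> {a. a \<odot>\<^bsub>M\<^esub> v = \<zero>\<^bsub>M\<^esub>}" using M.smult_one[OF v(1)] v(2) by simp
next
  fix b
  assume b: "b \<notin> {a. a \<odot>\<^bsub>M\<^esub> v = \<zero>\<^bsub>M\<^esub>}"
  have "b \<odot>\<^bsub>M\<^esub> v \<in> carrier M" using M.smult_closed[of b v] v(1) by simp
  then obtain c where "v = c \<odot>\<^bsub>M\<^esub> (b \<odot>\<^bsub>M\<^esub> v)"
    using simple_module_cyclic[of "b \<odot>\<^bsub>M\<^esub> v" v] b v(1) by blast
  then have "1 \<odot>\<^bsub>M\<^esub> v = (c * b) \<odot>\<^bsub>M\<^esub> v"
    using M.smult_one[OF v(1)] M.smult_assoc[of c b v] v(1) by simp
  then have "(1 - c * b) \<odot>\<^bsub>M\<^esub> v = \<zero>\<^bsub>M\<^esub>" by (simp add: smult_diff_zero_iff[OF v(1)])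
  then show "\<exists>c. 1 - c * b \<in> {a. a \<odot>\<^bsub>M\<^esub> v = \<zero>\<^bsub>M\<^esub>}" by blast
qed

text \<open>A vector u is sent to the fibre over u of the map a -> a v. Such a fibre is exactly a
  coset of the annihilator of v, so the inverse of the orbit map is obtained without choosing
  preimages.\<close>

lemma module_iso_quot_annihilator:
  assumes v: "v \<in> carrier M" "v \<noteq> \<zero>\<^bsub>M\<^esub>"
  shows "module_iso class_ring M (quot_module class_ring {a. a \<odot>\<^bsub>M\<^esub> v = \<zero>\<^bsub>M\<^esub>})"
proof -
  let ?L = "{a. a \<odot>\<^bsub>M\<^esub> v = \<zero>\<^bsub>M\<^esub>}"
  define f where "f u = {a. a \<odot>\<^bsub>M\<^esub> v = u}" for u
  note L = maximal_left_idealD(1)[OF maximal_annihilator[OF v]]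
  note simps = carrier_quot_module[OF L] add_quot_module[OF L] smult_quot_module[OF L]
  have f: "f (c \<odot>\<^bsub>M\<^esub> v) = coset ?L c" for c
    by (simp add: f_def coset_def smult_diff_zero_iff[OF v(1)])
  have f_closed: "f u \<in> carrier (quot_module class_ring ?L)" if u: "u \<in> carrier M" for u
  proof -
    obtain c where "u = c \<odot>\<^bsub>M\<^esub> v" using simple_module_cyclic[OF v u] by blast
    then show ?thesis by (simp add: f simps)
  qed
  have f_add: "f (u \<oplus>\<^bsub>M\<^esub> w) = f u \<oplus>\<^bsub>quot_module class_ring ?L\<^esub> f w"
    if uw: "u \<in> carrier M" "w \<in> carrier M" for u w
  proof -
    obtain c d where cd: "u = c \<odot>\<^bsub>M\<^esub> v" "w = d \<odot>\<^bsub>M\<^esub> v"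
      using simple_module_cyclic[OF v uw(1)] simple_module_cyclic[OF v uw(2)] by blast
    then have "u \<oplus>\<^bsub>M\<^esub> w = (c + d) \<odot>\<^bsub>M\<^esub> v" using M.smult_l_distr[of c d v] v(1) by simp
    then show ?thesis unfolding cd by (simp only: f simps)
  qed
  have f_smult: "f (a \<odot>\<^bsub>M\<^esub> u) = a \<odot>\<^bsub>quot_module class_ring ?L\<^esub> f u"
    if u: "u \<in> carrier M" for a u
  proof -
    obtain c where c: "u = c \<odot>\<^bsub>M\<^esub> v" using simple_module_cyclic[OF v u] by blast
    then have "a \<odot>\<^bsub>M\<^esub> u = (a * c) \<odot>\<^bsub>M\<^esub> v" using M.smult_assoc[of a c v] v(1) by simp
    then show ?thesis unfolding c by (simp only: f simps)
  qed
  have "f \<in> LinearCombinations.module_hom class_ring M (quot_module class_ring ?L)"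
    using f_closed f_add f_smult by (auto simp: LinearCombinations.module_hom_def)
  moreover have "bij_betw f (carrier M) (carrier (quot_module class_ring ?L))"
  proof (rule bij_betw_imageI)
    show "inj_on f (carrier M)"
    proof (rule inj_onI)
      fix u w
      assume "u \<in> carrier M" and eq: "f u = f w"
      then obtain c where "u = c \<odot>\<^bsub>M\<^esub> v" using simple_module_cyclic[OF v] by blast
      then have "c \<in> f u" by (simp add: f_def)
      with eq \<open>u = c \<odot>\<^bsub>M\<^esub> v\<close> show "u = w" by (simp add: f_def)
    qed
    have "coset ?L c \<in> f ` carrier M" for c
      using f[of c, symmetric] M.smult_closed[of c v] v(1) by simp
    then show "f ` carrier M = carrier (quot_module class_ring ?L)"
      using f_closed by (auto simp: simps(1))
  qed
  ultimately show ?thesis by (auto simp: module_iso_def)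
qed

end

lemma module_iso_trans:
  assumes "module_iso R M N" "module_iso R N P"
  shows "module_iso R M P"
proof -
  obtain f g where f: "f \<in> LinearCombinations.module_hom R M N" "bij_betw f (carrier M) (carrier N)"
    and g: "g \<in> LinearCombinations.module_hom R N P" "bij_betw g (carrier N) (carrier P)"
    using assms by (auto simp: module_iso_def)
  have "g \<circ> f \<in> LinearCombinations.module_hom R M P"
    using f(1) g(1) by (auto simp: LinearCombinations.module_hom_def Pi_iff)
  with bij_betw_trans[OF f(2) g(2)] show ?thesis by (auto simp: module_iso_def)
qed

lemma module_iso_sym:
  assumes "left_module R M" "module_iso R M N"
  shows "module_iso R N M"
proof -
  interpret left_module R M by (rule assms(1))
  obtain f where f: "f \<in> LinearCombinations.module_hom R M N" "bij_betw f (carrier M) (carrier N)"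
    using assms(2) by (auto simp: module_iso_def)
  define g where "g = inv_into (carrier M) f"
  have g: "bij_betw g (carrier N) (carrier M)" unfolding g_def by (rule bij_betw_inv_into[OF f(2)])
  have gf: "g (f u) = u" if "u \<in> carrier M" for u
    unfolding g_def using f(2) that by (simp add: bij_betw_inv_into_left)
  have fg: "f (g u) = u" if "u \<in> carrier N" for u
    unfolding g_def using f(2) that by (simp add: bij_betw_inv_into_right)
  have closed: "g u \<in> carrier M" if "u \<in> carrier N" for u
    using g that by (auto simp: bij_betw_def)
  have "g (u \<oplus>\<^bsub>N\<^esub> w) = g u \<oplus>\<^bsub>M\<^esub> g w" if "u \<in> carrier N" "w \<in> carrier N" for u w
    using gf[of "g u \<oplus>\<^bsub>M\<^esub> g w"] LinearCombinations.module_hom_add[OF f(1) closed[OF that(1)] closed[OF that(2)]] that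
    by (simp add: fg closed)
  moreover have "g (a \<odot>\<^bsub>N\<^esub> u) = a \<odot>\<^bsub>M\<^esub> g u" if "a \<in> carrier R" "u \<in> carrier N" for a u
    using gf[of "a \<odot>\<^bsub>M\<^esub> g u"] LinearCombinations.module_hom_smult[OF f(1) that(1) closed[OF that(2)]] that
    by (simp add: fg closed smult_closed)
  ultimately have "g \<in> LinearCombinations.module_hom R N M"
    using closed by (auto simp: LinearCombinations.module_hom_def)
  with g show ?thesis by (auto simp: module_iso_def)
qed

lemma iso_class_eqI:
  assumes "left_module R M" "module_iso R M N"
  shows "iso_class R M = iso_class R N"
  using module_iso_trans[OF assms(2)] module_iso_trans[OF module_iso_sym[OF assms]]
  by (auto simp: iso_class_def)

subsection \<open>The simple modules\<close>

lemma S_mod_eq: "S_mod \<alpha> = quot_module SJ (S_ideal \<alpha>)"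
  by (simp add: S_mod_def S_ideal_eq)

lemma V_mod_eq: "V_mod p \<alpha> \<beta> = quot_module SJ (V_ideal p \<alpha> \<beta>)"
  by (simp add: V_mod_def V_ideal_def)

text \<open>Starting from any nonzero v, the classification of maximal left ideals supplies a
  multiple u v whose annihilator is one of the model ideals; M is the quotient by that
  annihilator.\<close>

lemma simple_super_jordan_module:
  fixes M :: "('k::alg_closed_field super_jordan, 'm, 'c) module_scheme"
  assumes p: "CHAR('k) = p" "p > 0" and M: "simple_module SJ M"
  shows "(\<exists>\<alpha>. module_iso SJ M (S_mod \<alpha>)) \<or> (\<exists>\<alpha> \<beta>. \<alpha> \<noteq> 0 \<and> module_iso SJ M (V_mod p \<alpha> \<beta>))"
proof -
  interpret left_module "SJ :: 'k super_jordan ring" M using M by (simp add: simple_module_def)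
  obtain v where v: "v \<in> carrier M" "v \<noteq> \<zero>\<^bsub>M\<^esub>"
    using M M.zero_closed unfolding simple_module_def by blast
  obtain u where u: "u \<notin> {a. a \<odot>\<^bsub>M\<^esub> v = \<zero>\<^bsub>M\<^esub>}"
    and cases: "(\<exists>\<alpha>. {a. a * u \<in> {a. a \<odot>\<^bsub>M\<^esub> v = \<zero>\<^bsub>M\<^esub>}} = S_ideal \<alpha>) \<or>
      (\<exists>\<alpha> \<beta>. \<alpha> \<noteq> 0 \<and> {a. a * u \<in> {a. a \<odot>\<^bsub>M\<^esub> v = \<zero>\<^bsub>M\<^esub>}} = V_ideal p \<alpha> \<beta>)"
    using maximal_left_ideal_classification[OF p maximal_annihilator[OF M v]] by blast
  have "u \<odot>\<^bsub>M\<^esub> v \<in> carrier M" using smult_closed[of u v] v(1) by simp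
  moreover have "u \<odot>\<^bsub>M\<^esub> v \<noteq> \<zero>\<^bsub>M\<^esub>" using u by simp
  ultimately have "module_iso SJ M (quot_module SJ {a. a \<odot>\<^bsub>M\<^esub> (u \<odot>\<^bsub>M\<^esub> v) = \<zero>\<^bsub>M\<^esub>})"
    by (rule module_iso_quot_annihilator[OF M])
  moreover have "{a. a \<odot>\<^bsub>M\<^esub> (u \<odot>\<^bsub>M\<^esub> v) = \<zero>\<^bsub>M\<^esub>} = {a. a * u \<in> {a. a \<odot>\<^bsub>M\<^esub> v = \<zero>\<^bsub>M\<^esub>}}"
    using smult_assoc[of _ u v] v(1) by simp
  ultimately show ?thesis using cases unfolding S_mod_eq V_mod_eq by metis
qed

section \<open>The dimension of \<open>V_mod\<close> and the final classification\<close>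

lemma vectorspace_base_space:
  assumes "left_module (SJ :: 'k::field super_jordan ring) M"
  shows "vectorspace (class_ring :: 'k ring) (base_space M)"
proof -
  interpret left_module "SJ :: 'k super_jordan ring" M by (rule assms)
  have "abelian_group (base_space M)"
  proof (rule abelian_groupI)
    fix u
    assume "u \<in> carrier (base_space M)"
    then show "\<exists>v\<in>carrier (base_space M). v \<oplus>\<^bsub>base_space M\<^esub> u = \<zero>\<^bsub>base_space M\<^esub>"
      by (intro bexI[of _ "\<ominus>\<^bsub>M\<^esub> u"]) (simp_all add: base_space_def M.l_neg)
  qed (simp_all add: base_space_def M.a_ac)
  then have "Module.module (class_ring :: 'k ring) (base_space M)"
    using smult_closed smult_l_distr smult_r_distr smult_assoc smult_one
    by (auto simp: Module.module_def module_axioms_def class_cring.cring_axioms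
        base_space_def sj_const_add sj_const_mult)
  then show ?thesis by (simp add: vectorspace_def class_field)
qed

text \<open>The dimension is carried over from k^(2p) by an explicit linear bijection: the first p
  coordinates are the coefficients of f, the last p those of g, in f(t) + y g(t). Existence and
  uniqueness of the reduced form give surjectivity and injectivity.\<close>

lemma has_dimension_V_mod:
  assumes p: "CHAR('k::field) = p" "p > 0" and \<alpha>: "(\<alpha> :: 'k) \<noteq> 0"
  shows "has_dimension (V_mod p \<alpha> \<beta>) (2 * p)"
proof -
  let ?L = "V_ideal p \<alpha> \<beta>" and ?n = "2 * p"
  note L = V_ideal_vacuum(1)[of p \<alpha> \<beta>]
  interpret V: sj_vacuum ?L \<alpha> by unfold_locales (rule V_ideal_vacuum)+
  note simps = carrier_quot_module[OF L] add_quot_module[OF L] smult_quot_module[OF L]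
  let ?W = "base_space (V_mod p \<alpha> \<beta>)"
  have W: "vectorspace (class_ring :: 'k ring) ?W"
    unfolding V_mod_eq by (rule vectorspace_base_space[OF left_module_quot_module[OF L]])
  interpret vs: vec_space "TYPE('k)" ?n .
  define F where "F v = (\<Sum>i<p. monom (v $ i) i)" for v :: "'k vec"
  define G where "G v = (\<Sum>i<p. monom (v $ (p + i)) i)" for v :: "'k vec"
  define T where "T v = coset ?L (sj_eval (F v) sj_t + sj_y * sj_eval (G v) sj_t)" for v
  have coeff_FG: "coeff (F v) i = (if i < p then v $ i else 0)"
    "coeff (G v) i = (if i < p then v $ (p + i) else 0)" for v i
    by (auto simp: F_def G_def coeff_sum sum.delta)
  have deg: "degree (F v) < p" "degree (G v) < p" for v
    using p(2) by (auto intro!: degree_lessI simp: coeff_FG)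
  have F_add: "F (v + w) = F v + F w" "G (v + w) = G v + G w"
    if "v \<in> carrier_vec ?n" "w \<in> carrier_vec ?n" for v w
    using that by (auto simp: poly_eq_iff coeff_FG)
  have F_smult: "F (c \<cdot>\<^sub>v v) = Polynomial.smult c (F v)" "G (c \<cdot>\<^sub>v v) = Polynomial.smult c (G v)"
    if "v \<in> carrier_vec ?n" for c v
    using that by (auto simp: poly_eq_iff coeff_FG)
  have "T \<in> LinearCombinations.module_hom class_ring (module_vec TYPE('k) ?n) ?W"
  proof -
    have "T (v + w) = T v \<oplus>\<^bsub>?W\<^esub> T w" if "v \<in> carrier_vec ?n" "w \<in> carrier_vec ?n" for v w
      using F_add[OF that]
      by (simp add: T_def base_space_def V_mod_eq simps sj_eval_add algebra_simps)
    moreover have "T (c \<cdot>\<^sub>v v) = c \<odot>\<^bsub>?W\<^esub> T v" if "v \<in> carrier_vec ?n" for c v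
    proof -
      have "sj_y * (sj_const c * a) = sj_const c * (sj_y * a)" for a
        by (metis mult.assoc sj_const_commute)
      then show ?thesis using F_smult[OF that]
        by (simp add: T_def base_space_def V_mod_eq simps sj_eval_smult distrib_left)
    qed
    moreover have "T v \<in> carrier ?W" for v
      by (simp add: T_def base_space_def V_mod_eq simps)
    ultimately show ?thesis by (simp add: LinearCombinations.module_hom_def module_vec_simps)
  qed
  then interpret T: linear_map "class_ring :: 'k ring" "module_vec TYPE('k) ?n" ?W T
    using W vec_vs[where 'a = 'k, of ?n]
    by (simp add: linear_map_def mod_hom_def mod_hom_axioms_def vectorspace_def)
  have inj: "inj_on T (carrier_vec ?n)"
  proof (rule inj_onI)
    fix v w :: "'k vec"
    assume vw: "v \<in> carrier_vec ?n" "w \<in> carrier_vec ?n" and "T v = T w"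
    then have "sj_eval (F v - F w) sj_t + sj_y * sj_eval (G v - G w) sj_t \<in> ?L"
      by (simp add: T_def coset_eq_iff[OF L] sj_eval_diff algebra_simps)
    moreover have "degree (F v - F w) < p" "degree (G v - G w) < p"
      using deg by (auto intro: degree_diff_less)
    ultimately have "F v = F w" "G v = G w"
      using V.normal_form_unique[of "F v - F w" "G v - G w"] one_notin_V_ideal[OF \<alpha> p] p \<alpha> by auto
    then have eq: "v $ i = w $ i" "v $ (p + i) = w $ (p + i)" if "i < p" for i
      using coeff_FG[of v i] coeff_FG[of w i] that by simp_all
    show "v = w"
    proof (rule eq_vecI)
      fix i assume "i < dim_vec w"
      then have "i < 2 * p" using vw by simp
      then show "v $ i = w $ i"
        using eq(1)[of i] eq(2)[of "i - p"] by (cases "i < p") auto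
    qed (use vw in simp)
  qed
  have surj: "T ` carrier_vec ?n = carrier ?W"
  proof
    show "T ` carrier_vec ?n \<subseteq> carrier ?W"
      by (auto simp: T_def base_space_def V_mod_eq simps)
    show "carrier ?W \<subseteq> T ` carrier_vec ?n"
    proof
      fix u
      assume "u \<in> carrier ?W"
      then obtain b where b: "u = coset ?L b"
        by (auto simp: base_space_def V_mod_eq simps)
      obtain f g where fg: "degree f < p" "degree g < p"
        "b - (sj_eval f sj_t + sj_y * sj_eval g sj_t) \<in> ?L"
        using V.normal_form_reduced[unfolded p(1), OF p(2) V_ideal_vacuum(4), of b] by blast
      define v where "v = vec ?n (\<lambda>i. if i < p then coeff f i else coeff g (i - p))"
      have "F v = f" "G v = g"
        using fg(1,2) by (auto simp: poly_eq_iff coeff_FG v_def coeff_eq_0)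
      then have "u = T v" using fg(3) by (simp add: b T_def coset_eq_iff[OF L])
      then show "u \<in> T ` carrier_vec ?n" by (auto simp: v_def)
    qed
  qed
  show ?thesis
    unfolding has_dimension_def
    using W T.dim_eq[OF vs.fin_dim] T.surj_fin_dim[OF vs.fin_dim] inj surj vs.dim_is_n
    by (simp add: module_vec_simps)
qed

text \<open>The equality of sets of classes concerns one carrier type; the last conjunct gives the
  classification on an arbitrary carrier type.\<close>

theorem theorem4p6:
  fixes p :: nat
  assumes "CHAR('k::alg_closed_field) = p" and "p > 2"
  shows
    "(\<forall>\<alpha>::'k. simple_module SJ (S_mod \<alpha>)) \<and>
     (\<forall>\<alpha> \<beta> :: 'k. \<alpha> \<noteq> 0 \<longrightarrow>
        simple_module SJ (V_mod p \<alpha> \<beta>) \<and> has_dimension (V_mod p \<alpha> \<beta>) (2 * p)) \<and>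
     {iso_class SJ M | M :: ('k super_jordan, 'k super_jordan set) module. simple_module SJ M} =
       ({iso_class SJ (S_mod \<alpha>) | \<alpha> :: 'k. True} \<union>
        {iso_class SJ (V_mod p \<alpha> \<beta>) | \<alpha> \<beta> :: 'k. \<alpha> \<noteq> 0}
          :: ('k super_jordan, 'k super_jordan set) module set set) \<and>
     (\<forall>M :: ('k super_jordan, 'm) module. simple_module SJ M \<longrightarrow>
        (\<exists>\<alpha>. module_iso SJ M (S_mod \<alpha>)) \<or>
        (\<exists>\<alpha> \<beta>. \<alpha> \<noteq> 0 \<and> module_iso SJ M (V_mod p \<alpha> \<beta>)))"
proof (intro conjI)
  have p: "CHAR('k) = p" "p > 0" using assms by simp_all
  have S: "simple_module SJ (S_mod \<alpha>)" for \<alpha> :: 'k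
    by (simp add: S_mod_eq simple_quot_module S_ideal_maximal)
  have V: "simple_module SJ (V_mod p \<alpha> \<beta>)" if "\<alpha> \<noteq> 0" for \<alpha> \<beta> :: 'k
    by (simp add: V_mod_eq simple_quot_module V_ideal_maximal p that)
  have left: "left_module SJ M" if "simple_module SJ M"
    for M :: "('k super_jordan, 'k super_jordan set) module"
    using that by (simp add: simple_module_def)
  show "\<forall>\<alpha>::'k. simple_module SJ (S_mod \<alpha>)" using S by blast
  show "\<forall>\<alpha> \<beta> :: 'k. \<alpha> \<noteq> 0 \<longrightarrow>
      simple_module SJ (V_mod p \<alpha> \<beta>) \<and> has_dimension (V_mod p \<alpha> \<beta>) (2 * p)"
    using V has_dimension_V_mod[OF p] by blast
  show "{iso_class SJ M | M :: ('k super_jordan, 'k super_jordan set) module. simple_module SJ M} =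
      ({iso_class SJ (S_mod \<alpha>) | \<alpha> :: 'k. True} \<union>
        {iso_class SJ (V_mod p \<alpha> \<beta>) | \<alpha> \<beta> :: 'k. \<alpha> \<noteq> 0}
          :: ('k super_jordan, 'k super_jordan set) module set set)" (is "?A = ?B")
  proof
    show "?A \<subseteq> ?B"
    proof
      fix C
      assume "C \<in> ?A"
      then obtain M :: "('k super_jordan, 'k super_jordan set) module"
        where M: "simple_module SJ M" "C = iso_class SJ M" by blast
      from simple_super_jordan_module[OF p M(1)] show "C \<in> ?B"
        unfolding M(2) using iso_class_eqI[OF left[OF M(1)]] by blast
    qed
    show "?B \<subseteq> ?A" using S V by blast
  qed
  show "\<forall>M :: ('k super_jordan, 'm) module. simple_module SJ M \<longrightarrow>
      (\<exists>\<alpha>. module_iso SJ M (S_mod \<alpha>)) \<or>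
      (\<exists>\<alpha> \<beta>. \<alpha> \<noteq> 0 \<and> module_iso SJ M (V_mod p \<alpha> \<beta>))"
    using simple_super_jordan_module[OF p] by blast
qed

end
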